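(* There is an absolute constant $C>0$ such that for every finite undirected graph $G=(V,E,w)$ with $n=|V|$ and every integer $k$ with $2\le k\le n$ and $\lambda_k>0$, $$\phi(G)\le C\,k\,\frac{\lambda_2}{\sqrt{\lambda_k}}.$$
   Context: $G=(V,E,w)$ is a finite undirected graph with positive edge weights $w:E\to(0,\infty)$. The weighted degree of $v$ is $w(v)=\sum_{u\sim v}w(u,v)$; it is assumed that $w(v)\ge 1$ for all $v$. For $S\subseteq V$, $\mathrm{vol}(S)=\sum_{v\in S}w(v)$, $\overline S=V\setminus S$, and $w(E(S,\overline S))$ is the total weight of edges with exactly one endpoint in $S$. The conductance of $\emptyset\ne S\subsetneq V$ is $\phi(S)=w(E(S,\overline S))/\min\{\mathrm{vol}(S),\mathrm{vol}(\overline S)\}$, and $\phi(G)=\min_{\emptyset\ne S\subsetneq V}\phi(S)$. Let $A$ be the weighted adjacency matrix, $D$ the diagonal matrix of weighted degrees, and $\mathcal L=I-D^{-1/2}AD^{-1/2}$ the normalized Laplacian, with eigenvalues $0=\lambda_1\le\lambda_2\le\dots\le\lambda_n\le 2$. *)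

theory Defs
  imports "HOL-Analysis.Analysis" "Jordan_Normal_Form.Char_Poly"
begin

text \<open>A finite weighted undirected graph on vertex set {0..<n}: weight function w,
  w i j > 0 means an edge with that weight, w i j = 0 means no edge.\<close>

definition wgraph :: "nat \<Rightarrow> (nat \<Rightarrow> nat \<Rightarrow> real) \<Rightarrow> bool" where
  "wgraph n w \<longleftrightarrow> (\<forall>i<n. \<forall>j<n. w i j = w j i \<and> w i j \<ge> 0) \<and> (\<forall>i<n. w i i = 0)"

definition wdeg :: "nat \<Rightarrow> (nat \<Rightarrow> nat \<Rightarrow> real) \<Rightarrow> nat \<Rightarrow> real" where
  "wdeg n w v = (\<Sum>u<n. w v u)"

definition vol :: "nat \<Rightarrow> (nat \<Rightarrow> nat \<Rightarrow> real) \<Rightarrow> nat set \<Rightarrow> real" where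
  "vol n w S = (\<Sum>v\<in>S. wdeg n w v)"

definition cut_weight :: "nat \<Rightarrow> (nat \<Rightarrow> nat \<Rightarrow> real) \<Rightarrow> nat set \<Rightarrow> real" where
  "cut_weight n w S = (\<Sum>u\<in>S. \<Sum>v\<in>{..<n} - S. w u v)"

definition conductance :: "nat \<Rightarrow> (nat \<Rightarrow> nat \<Rightarrow> real) \<Rightarrow> nat set \<Rightarrow> real" where
  "conductance n w S = cut_weight n w S / min (vol n w S) (vol n w ({..<n} - S))"

definition graph_conductance :: "nat \<Rightarrow> (nat \<Rightarrow> nat \<Rightarrow> real) \<Rightarrow> real" where
  "graph_conductance n w =
     Min {conductance n w S | S. S \<subseteq> {..<n} \<and> S \<noteq> {} \<and> S \<noteq> {..<n}}"

definition norm_laplacian :: "nat \<Rightarrow> (nat \<Rightarrow> nat \<Rightarrow> real) \<Rightarrow> real mat" where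
  "norm_laplacian n w = mat n n (\<lambda>(i,j). (if i = j then 1 else 0)
        - w i j / (sqrt (wdeg n w i) * sqrt (wdeg n w j)))"

definition sorted_eigenvalues :: "real mat \<Rightarrow> real list" where
  "sorted_eigenvalues A = (THE es. sorted es \<and> length es = dim_row A \<and>
       char_poly A = (\<Prod>e\<leftarrow>es. [:- e, 1:]))"

text \<open>lambda_k, 1-indexed: lambda_1 \<le> lambda_2 \<le> ... \<le> lambda_n.\<close>
definition lap_eig :: "nat \<Rightarrow> (nat \<Rightarrow> nat \<Rightarrow> real) \<Rightarrow> nat \<Rightarrow> real" where
  "lap_eig n w k = sorted_eigenvalues (norm_laplacian n w) ! (k - 1)"

end

theory Submission
  imports Defs "Jordan_Normal_Form.Spectral_Radius" "HOL-Combinatorics.List_Permutation"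
begin

text \<open>Let \<open>f\<close> be the positive part of an eigenvector for \<open>\<lambda>\<^sub>2\<close>, with the sign chosen such that the
  support of \<open>f\<close> has at most half of the volume; its Rayleigh quotient is at most \<open>\<lambda>\<^sub>2\<close>. Cut the range
  of \<open>f\<close> greedily into intervals such that the weighted squared distances of the values of \<open>f\<close> in
  each interval to its endpoints (the tent functions below) add up to \<open>c = 3 \<lambda>\<^sub>2 \<parallel>f\<parallel>\<^sup>2 / (k \<lambda>\<^sub>k)\<close>.
  If \<open>2k\<close> intervals did not suffice, the tent functions would be \<open>2k\<close> disjointly supported test
  functions with total energy at most that of \<open>f\<close>, and the \<open>k\<close> of them with least energy would
  contradict the min-max principle for \<open>\<lambda>\<^sub>k\<close>. Hence \<open>f\<close> is close to a function with few values.
  Now apply the Cheeger rounding argument not to \<open>f\<^sup>2\<close> but to \<open>h = H \<circ> f\<close>, where \<open>H\<close> is the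
  antiderivative of the distance to the nearest threshold: \<open>h \<ge> f\<^sup>2 / 8k\<close>, while the total variation of
  \<open>h\<close> is controlled by the energy of \<open>f\<close> and its distance to the step function.\<close>

unbundle no vec_syntax and no inner_syntax

section \<open>Spectral theorem for real symmetric matrices\<close>

text \<open>Over the complex numbers some eigenvalue exists. The Hermitian form at its eigenvector
  is real, hence so is the eigenvalue; it is then a root of the real characteristic polynomial,
  which yields a real eigenvector.\<close>

lemma symmetric_mat_eigenvector:
  fixes A :: "real mat"
  assumes A: "A \<in> carrier_mat n n" and sym: "A\<^sup>T = A" and n: "n > 0"
  obtains e v where "v \<in> carrier_vec n" "v \<bullet> v = 1" "A *\<^sub>v v = e \<cdot>\<^sub>v v"
proof -
  define B where "B = map_mat complex_of_real A"
  have B: "B \<in> carrier_mat n n" using A by (simp add: B_def)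
  obtain c where c: "eigenvalue B c"
    using spectrum_non_empty[OF B n] by (auto simp: spectrum_def)
  then obtain z where z: "z \<in> carrier_vec n" "z \<noteq> 0\<^sub>v n" "B *\<^sub>v z = c \<cdot>\<^sub>v z"
    using B by (auto simp: eigenvalue_def eigenvector_def)
  have Aij: "A $$ (i,j) = A $$ (j,i)" if "i < n" "j < n" for i j
    by (metis A carrier_matD index_transpose_mat(1) sym that)
  \<comment> \<open>The Hermitian form of \<open>A\<close> at \<open>z\<close>: the eigenvalue
    equation makes it \<open>c\<close> times the squared norm of \<open>z\<close>, and symmetry
    makes it equal to its own conjugate.\<close>
  define S where "S = (\<Sum>i<n. cnj (z $ i) * (\<Sum>j<n. of_real (A $$ (i,j)) * z $ j))"
  have row: "(\<Sum>j<n. of_real (A $$ (i,j)) * z $ j) = c * z $ i" if "i < n" for i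
  proof -
    have "(B *\<^sub>v z) $ i = (\<Sum>j<n. of_real (A $$ (i,j)) * z $ j)"
      using that A z(1) by (simp add: B_def scalar_prod_def lessThan_atLeast0)
    then show ?thesis using z that by simp
  qed
  have S1: "S = c * of_real (\<Sum>i<n. (cmod (z $ i))\<^sup>2)"
  proof -
    have "S = (\<Sum>i<n. cnj (z $ i) * (c * z $ i))"
      unfolding S_def by (intro sum.cong refl) (simp add: row)
    then show ?thesis by (simp add: sum_distrib_left complex_norm_square mult_ac del: of_real_power)
  qed
  have "cnj S = S"
  proof -
    have "cnj S = (\<Sum>i<n. \<Sum>j<n. of_real (A $$ (i,j)) * cnj (z $ j) * z $ i)"
      by (simp add: S_def sum_distrib_left mult_ac)
    also have "\<dots> = (\<Sum>j<n. \<Sum>i<n. of_real (A $$ (i,j)) * cnj (z $ j) * z $ i)"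
      by (rule sum.swap)
    also have "\<dots> = S"
      unfolding S_def sum_distrib_left
      by (intro sum.cong refl) (simp add: Aij mult_ac)
    finally show ?thesis .
  qed
  moreover have "(\<Sum>i<n. (cmod (z $ i))\<^sup>2) \<noteq> 0"
  proof
    assume "(\<Sum>i<n. (cmod (z $ i))\<^sup>2) = 0"
    then have "\<forall>i<n. z $ i = 0" by (simp add: sum_nonneg_eq_0_iff)
    then have "z = 0\<^sub>v n" using z(1) by (intro eq_vecI) auto
    then show False using z(2) by simp
  qed
  ultimately have "cnj c = c"
    unfolding S1 complex_cnj_mult complex_cnj_complex_of_real mult_cancel_right of_real_eq_0_iff
    by blast
  then have c': "c = of_real (Re c)" by (metis Reals_cnj_iff of_real_Re)
  have "poly (char_poly B) c = 0" using c eigenvalue_root_char_poly[OF B] by simp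
  then have "poly (map_poly complex_of_real (char_poly A)) (of_real (Re c)) = 0"
    using of_real_hom.char_poly_hom[OF A, where ?'a = complex] c' by (metis B_def)
  then have "poly (char_poly A) (Re c) = 0" by (simp del: of_real_Re)
  then have "eigenvalue A (Re c)" using eigenvalue_root_char_poly[OF A] by simp
  then obtain v where v: "v \<in> carrier_vec n" "v \<noteq> 0\<^sub>v n" "A *\<^sub>v v = Re c \<cdot>\<^sub>v v"
    using A by (auto simp: eigenvalue_def eigenvector_def)
  have sq: "v \<bullet> v = (\<Sum>i<n. (v $ i)\<^sup>2)"
    using v(1) by (simp add: scalar_prod_def power2_eq_square lessThan_atLeast0)
  have "v \<bullet> v > 0"
  proof -
    have "v \<bullet> v \<noteq> 0"
    proof
      assume "v \<bullet> v = 0"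
      then have "\<forall>i<n. v $ i = 0" by (simp add: sq sum_nonneg_eq_0_iff)
      then have "v = 0\<^sub>v n" using v(1) by (intro eq_vecI) auto
      then show False using v(2) by simp
    qed
    moreover have "v \<bullet> v \<ge> 0" by (simp add: sq sum_nonneg)
    ultimately show ?thesis by simp
  qed
  define u where "u = (1 / sqrt (v \<bullet> v)) \<cdot>\<^sub>v v"
  show ?thesis
  proof
    show "u \<in> carrier_vec n" using v by (simp add: u_def)
    show "u \<bullet> u = 1" using v(1) \<open>v \<bullet> v > 0\<close> by (simp add: u_def)
    show "A *\<^sub>v u = Re c \<cdot>\<^sub>v u"
      unfolding u_def using v A by (simp add: mult_mat_vec smult_smult_assoc mult.commute)
  qed
qed

text \<open>The Householder reflection in the hyperplane orthogonal to \<open>v - e\<close>, where \<open>e\<close> is the last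
  unit vector; for \<open>v = e\<close> the division by zero makes it the identity.\<close>

lemma reflection_to_unit_vector:
  fixes v :: "real vec"
  assumes v: "v \<in> carrier_vec (Suc n)" "v \<bullet> v = 1"
  obtains H where "H \<in> carrier_mat (Suc n) (Suc n)" "H\<^sup>T = H" "H * H = 1\<^sub>m (Suc n)" "col H n = v"
proof -
  define q where "q i = v $ i - (if i = n then 1 else 0)" for i
  define s where "s = (\<Sum>i<Suc n. q i * q i)"
  define H where "H = mat (Suc n) (Suc n) (\<lambda>(i,j). (if i = j then 1 else 0) - 2 * q i * q j / s)"
  have vv: "(\<Sum>i<Suc n. v $ i * v $ i) = 1"
    using v by (simp add: scalar_prod_def lessThan_atLeast0)
  \<comment> \<open>Both \<open>v\<close> and the last unit vector have norm 1, so the squared norm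
    of their difference is \<open>2 - 2 * v $ n\<close>.\<close>
  have s: "s = - 2 * q n"
    using vv by (simp add: s_def q_def algebra_simps)
  have q0: "q i = 0" if "s = 0" "i < Suc n" for i
  proof -
    have "\<forall>i\<in>{..<Suc n}. q i * q i = 0"
      using that(1) unfolding s_def by (subst sum_nonneg_eq_0_iff[symmetric]) auto
    then show ?thesis using that(2) by auto
  qed
  show ?thesis
  proof
    show "H \<in> carrier_mat (Suc n) (Suc n)" by (simp add: H_def)
    show "H\<^sup>T = H" by (rule eq_matI) (auto simp: H_def)
    show "H * H = 1\<^sub>m (Suc n)"
    proof (rule eq_matI)
      fix i j assume "i < dim_row (1\<^sub>m (Suc n))" "j < dim_col (1\<^sub>m (Suc n))"
      then have ij: "i < Suc n" "j < Suc n" by auto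
      have "(H * H) $$ (i,j) = (\<Sum>l<Suc n. ((if i = l then 1 else 0) - 2 * q i * q l / s) *
              ((if l = j then 1 else 0) - 2 * q l * q j / s))"
        using ij by (simp add: H_def scalar_prod_def lessThan_atLeast0)
      also have "\<dots> = (\<Sum>l<Suc n. (if i = l then (if l = j then 1 else 0) else 0))
            - (\<Sum>l<Suc n. (if l = i then 2 * q l * q j / s else 0))
            - (\<Sum>l<Suc n. (if l = j then 2 * q i * q l / s else 0))
            + (\<Sum>l<Suc n. 4 * q i * q j / (s * s) * (q l * q l))"
        unfolding sum_subtractf[symmetric] sum.distrib[symmetric]
        by (intro sum.cong refl) (auto simp: algebra_simps)
      also have "\<dots> = (if i = j then 1 else 0) - 2 * q i * q j / s - 2 * q i * q j / s
            + 4 * q i * q j / (s * s) * s"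
        using ij unfolding s_def[symmetric] sum_distrib_left[symmetric] by simp
      also have "\<dots> = (if i = j then 1 else 0)" by (cases "s = 0") (auto simp: field_simps)
      finally show "(H * H) $$ (i,j) = 1\<^sub>m (Suc n) $$ (i,j)" using ij by simp
    qed (auto simp: H_def)
    show "col H n = v"
    proof (rule eq_vecI)
      fix i assume "i < dim_vec v"
      then have i: "i < Suc n" using v by simp
      have "(if i = n then 1 else 0) - 2 * q i * q n / s = v $ i"
      proof (cases "s = 0")
        case True
        then show ?thesis using q0[OF True i] by (simp add: q_def)
      next
        case False
        then have "2 * q i * q n / s = - q i" using s by (simp add: field_simps)
        then show ?thesis by (simp add: q_def)
      qed
      then show "col H n $ i = v $ i" using i by (simp add: H_def)
    qed (use v in \<open>simp add: H_def\<close>)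
  qed
qed

text \<open>Deflation: a reflection moves a unit eigenvector to the last coordinate. By symmetry the
  conjugated matrix then splits into a block of size \<open>n\<close> and a block of size 1, and
  induction handles the former.\<close>

lemma symmetric_mat_orthogonally_diagonalizable:
  fixes A :: "real mat"
  assumes "A \<in> carrier_mat n n" "A\<^sup>T = A"
  shows "\<exists>P. P \<in> carrier_mat n n \<and> P\<^sup>T * P = 1\<^sub>m n \<and> diagonal_mat (P\<^sup>T * A * P)"
  using assms
proof (induction n arbitrary: A)
  case 0
  then show ?case by (intro exI[of _ "1\<^sub>m 0"]) (auto simp: diagonal_mat_def)
next
  case (Suc n)
  note A = Suc.prems(1)
  obtain e v where v: "v \<in> carrier_vec (Suc n)" "v \<bullet> v = 1" "A *\<^sub>v v = e \<cdot>\<^sub>v v"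
    using symmetric_mat_eigenvector[OF Suc.prems] by blast
  obtain H where H: "H \<in> carrier_mat (Suc n) (Suc n)" "H\<^sup>T = H" "H * H = 1\<^sub>m (Suc n)" "col H n = v"
    using reflection_to_unit_vector[OF v(1,2)] by blast
  define B where "B = H * A * H"
  have B: "B \<in> carrier_mat (Suc n) (Suc n)" using A H by (simp add: B_def)
  have Bsym: "B\<^sup>T = B"
    unfolding B_def using A H Suc.prems(2)
    by (simp add: transpose_mult[of _ "Suc n" "Suc n" _ "Suc n"] assoc_mult_mat[of _ "Suc n" "Suc n" _ "Suc n" _ "Suc n"])
  have Bn: "B $$ (i,n) = (if i = n then e else 0)" if i: "i < Suc n" for i
  proof -
    \<comment> \<open>Column \<open>n\<close> of the identity \<open>H * H\<close> shows that
      \<open>H\<close> maps \<open>v\<close> back to the last unit vector.\<close>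
    have "col (H * H) n = H *\<^sub>v v" by (subst col_mult2[OF H(1) H(1)]) (simp_all add: H(4))
    then have Hv: "H *\<^sub>v v = unit_vec (Suc n) n" using H by simp
    have "col B n = (H * A) *\<^sub>v v"
      unfolding B_def by (subst col_mult2[OF mult_carrier_mat[OF H(1) A] H(1)]) (simp_all add: H(4))
    also have "\<dots> = H *\<^sub>v (e \<cdot>\<^sub>v v)"
      by (subst assoc_mult_mat_vec[OF H(1) A v(1)]) (simp add: v(3))
    also have "\<dots> = e \<cdot>\<^sub>v unit_vec (Suc n) n" using H v Hv by (simp add: mult_mat_vec)
    finally have "col B n $ i = (e \<cdot>\<^sub>v unit_vec (Suc n) n) $ i" by simp
    then show ?thesis using i B by simp
  qed
  have Bn': "B $$ (n,i) = (if i = n then e else 0)" if "i < Suc n" for i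
    using Bn[OF that] Bsym B that by (metis carrier_matD index_transpose_mat(1) lessI)
  define C where "C = mat n n (\<lambda>(i,j). B $$ (i,j))"
  have C: "C \<in> carrier_mat n n" by (simp add: C_def)
  have "C\<^sup>T = C"
  proof (rule eq_matI)
    fix i j assume "i < dim_row C" "j < dim_col C"
    then have "i < n" "j < n" by (auto simp: C_def)
    then show "C\<^sup>T $$ (i,j) = C $$ (i,j)"
      using Bsym B by (simp add: C_def) (metis carrier_matD index_transpose_mat(1) less_SucI)
  qed (auto simp: C_def)
  from Suc.IH[OF C this] obtain P where P: "P \<in> carrier_mat n n" "P\<^sup>T * P = 1\<^sub>m n"
    "diagonal_mat (P\<^sup>T * C * P)" by blast
  define E where "E = mat 1 1 (\<lambda>_. e)"
  have E: "E \<in> carrier_mat 1 1" by (simp add: E_def)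
  have Bblk: "B = four_block_mat C (0\<^sub>m n 1) (0\<^sub>m 1 n) E"
    by (rule eq_matI) (use B Bn Bn' in \<open>auto simp: C_def E_def less_Suc_eq\<close>)
  define Q where "Q = four_block_mat P (0\<^sub>m n 1) (0\<^sub>m 1 n) (1\<^sub>m 1)"
  have Q: "Q \<in> carrier_mat (Suc n) (Suc n)"
    using four_block_carrier_mat[OF P(1) one_carrier_mat[of 1]] by (simp add: Q_def)
  have QT: "Q\<^sup>T = four_block_mat P\<^sup>T (0\<^sub>m n 1) (0\<^sub>m 1 n) (1\<^sub>m 1)"
    using P by (simp add: Q_def transpose_four_block_mat[of _ n n _ 1 _ 1])
  have QTc: "Q\<^sup>T \<in> carrier_mat (Suc n) (Suc n)" using Q by simp
  have QQ: "Q\<^sup>T * Q = 1\<^sub>m (Suc n)"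
    unfolding QT unfolding Q_def using P
    by (subst mult_four_block_mat[of _ n n _ 1 _ 1 _ _ n _ 1]) (auto intro!: eq_matI)
  have QBQ: "Q\<^sup>T * B * Q = four_block_mat (P\<^sup>T * C * P) (0\<^sub>m n 1) (0\<^sub>m 1 n) E"
    unfolding QT Bblk unfolding Q_def using P C E
    by (subst mult_four_block_mat[of _ n n _ 1 _ 1 _ _ n _ 1], (simp; fail)+)+
  define R where "R = H * Q"
  have R: "R \<in> carrier_mat (Suc n) (Suc n)" using H Q by (simp add: R_def)
  have RT: "R\<^sup>T = Q\<^sup>T * H"
    using H Q by (simp add: R_def transpose_mult[of _ "Suc n" "Suc n" _ "Suc n"])
  note assoc = assoc_mult_mat[of _ "Suc n" "Suc n" _ "Suc n" _ "Suc n"]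
  have "R\<^sup>T * R = Q\<^sup>T * (H * H) * Q"
    unfolding RT unfolding R_def using H(1) Q QTc by (simp add: assoc)
  then have "R\<^sup>T * R = 1\<^sub>m (Suc n)" using H Q QTc QQ by simp
  moreover have "R\<^sup>T * A * R = Q\<^sup>T * B * Q"
    unfolding RT unfolding R_def B_def using H(1) Q QTc A by (simp add: assoc)
  moreover have "diagonal_mat (Q\<^sup>T * B * Q)"
    unfolding QBQ using P C E by (auto simp: diagonal_mat_def)
  ultimately show ?case using R by auto
qed

section \<open>Sorted eigenvalues and the entrywise spectral decomposition\<close>

lemma proots_prod_linear_factors:
  "proots (\<Prod>e\<leftarrow>es. [:- e, 1:]) = mset (es :: 'a :: idom list)"
proof (induction es)
  case (Cons e es)
  have "(\<Prod>e\<leftarrow>es. [:- e, 1:]) \<noteq> 0" by (auto simp: prod_list_zero_iff)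
  then show ?case using Cons by (simp add: proots_mult del: mult_pCons_left)
qed simp

text \<open>Resolves the definite description in \<open>sorted_eigenvalues\<close>: the multiset of
  roots determines the list up to order, and sortedness fixes the order.\<close>

lemma sorted_eigenvaluesI:
  assumes "sorted es" "length es = dim_row A" "char_poly A = (\<Prod>e\<leftarrow>es. [:- e, 1:])"
  shows "sorted_eigenvalues A = es"
  unfolding sorted_eigenvalues_def
proof (rule the_equality)
  fix es' assume "sorted es' \<and> length es' = dim_row A \<and> char_poly A = (\<Prod>e\<leftarrow>es'. [:- e, 1:])"
  then have "sorted es'" "mset es' = mset es"
    using assms(3) by (simp_all flip: proots_prod_linear_factors)
  then show "es' = es" using assms(1) by (metis properties_for_sort)
qed (use assms in blast)

text \<open>Orthogonal diagonalization in coordinates: \<open>u i\<close> is the column of the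
  diagonalizing matrix that belongs to entry \<open>i\<close> of the sorted list. The last two
  conclusions are completeness and orthonormality.\<close>

lemma symmetric_mat_spectral:
  assumes A: "A \<in> carrier_mat n n" and sym: "A\<^sup>T = A"
  obtains u where
    "length (sorted_eigenvalues A) = n" "sorted (sorted_eigenvalues A)"
    "\<And>a b. a < n \<Longrightarrow> b < n \<Longrightarrow>
      A $$ (a,b) = (\<Sum>i<n. sorted_eigenvalues A ! i * u i a * u i b)"
    "\<And>a b. a < n \<Longrightarrow> b < n \<Longrightarrow> (\<Sum>i<n. u i a * u i b) = (if a = b then 1 else 0)"
    "\<And>i j. i < n \<Longrightarrow> j < n \<Longrightarrow> (\<Sum>a<n. u i a * u j a) = (if i = j then 1 else 0)"
proof -
  obtain P where P: "P \<in> carrier_mat n n" "P\<^sup>T * P = 1\<^sub>m n" "diagonal_mat (P\<^sup>T * A * P)"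
    using symmetric_mat_orthogonally_diagonalizable[OF assms] by blast
  have PT: "P\<^sup>T \<in> carrier_mat n n" using P by simp
  \<comment> \<open>A one-sided inverse of a square matrix is two-sided; this is the source of
    completeness.\<close>
  have PP: "P * P\<^sup>T = 1\<^sub>m n"
    using mat_mult_left_right_inverse[OF PT P(1,2)] .
  define D where "D = P\<^sup>T * A * P"
  have D: "D \<in> carrier_mat n n" using P A PT by (simp add: D_def)
  have Dij: "D $$ (i,j) = (if i = j then D $$ (i,i) else 0)" if "i < n" "j < n" for i j
    using P(3) D that unfolding D_def[symmetric] by (auto simp: diagonal_mat_def)
  note assoc = assoc_mult_mat[of _ n n _ n _ n]
  have "P * D * P\<^sup>T = (P * P\<^sup>T) * A * (P * P\<^sup>T)"
    unfolding D_def using P(1) PT A by (simp add: assoc)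
  then have APD: "A = P * D * P\<^sup>T" using A by (simp add: PP)
  have "similar_mat A D"
    by (rule similar_matI[of _ _ P "P\<^sup>T" n]) (use A D P PT PP APD in auto)
  then have "char_poly A = char_poly D" by (rule char_poly_similar)
  also have "\<dots> = (\<Prod>e\<leftarrow>diag_mat D. [:- e, 1:])"
    by (rule char_poly_upper_triangular[OF D]) (use D Dij in \<open>auto simp: upper_triangular_def\<close>)
  also have "\<dots> = (\<Prod>e\<leftarrow>sort (diag_mat D). [:- e, 1:])"
    by (rule prod_mset_prod_list[THEN subst]) (simp flip: prod_mset_prod_list)
  finally have es: "sorted_eigenvalues A = sort (diag_mat D)"
    using A D by (intro sorted_eigenvaluesI) (auto simp: diag_mat_def)
  have len: "length (sort (diag_mat D)) = n" "length (diag_mat D) = n"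
    using D by (auto simp: diag_mat_def)
  \<comment> \<open>The diagonal of \<open>D\<close> need not be sorted, so its columns are
    renumbered by \<open>p\<close>.\<close>
  obtain p where p: "bij_betw p {..<n} {..<n}" "\<And>i. i < n \<Longrightarrow> sort (diag_mat D) ! i = diag_mat D ! p i"
    using permutation_Ex_bij[of "sort (diag_mat D)" "diag_mat D"] len by auto
  have pn: "p i < n" if "i < n" for i using p(1) that by (auto simp: bij_betw_def)
  have ev: "sorted_eigenvalues A ! i = D $$ (p i, p i)" if "i < n" for i
    using p(2)[OF that] pn[OF that] D by (simp add: es diag_mat_def)
  have PPab: "(\<Sum>i<n. P $$ (a,i) * P $$ (b,i)) = (if a = b then 1 else 0)" if "a < n" "b < n" for a b
  proof -
    have "(P * P\<^sup>T) $$ (a,b) = (\<Sum>i<n. P $$ (a,i) * P $$ (b,i))"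
      using that P(1) by (simp add: scalar_prod_def lessThan_atLeast0)
    then show ?thesis using that by (simp add: PP)
  qed
  show ?thesis
  proof
    let ?u = "\<lambda>i a. P $$ (a, p i)"
    show "length (sorted_eigenvalues A) = n" "sorted (sorted_eigenvalues A)"
      by (simp_all add: es len)
    fix a b assume ab: "a < n" "b < n"
    have PD: "(P * D) $$ (a,i) = P $$ (a,i) * D $$ (i,i)" if "i < n" for i
    proof -
      have "(P * D) $$ (a,i) = (\<Sum>l<n. P $$ (a,l) * D $$ (l,i))"
        using that ab P(1) D by (simp add: scalar_prod_def lessThan_atLeast0)
      also have "\<dots> = (\<Sum>l<n. if l = i then P $$ (a,l) * D $$ (i,i) else 0)"
        by (intro sum.cong refl, subst Dij) (use that in auto)
      finally show ?thesis using that by simp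
    qed
    have "(M * P\<^sup>T) $$ (a,b) = (\<Sum>i<n. M $$ (a,i) * P $$ (b,i))" if "M \<in> carrier_mat n n" for M
      using that ab P(1) by (simp add: scalar_prod_def lessThan_atLeast0)
    then have "A $$ (a,b) = (\<Sum>i<n. (P * D) $$ (a,i) * P $$ (b,i))"
      using APD mult_carrier_mat[OF P(1) D] by metis
    also have "\<dots> = (\<Sum>i<n. D $$ (i,i) * P $$ (a,i) * P $$ (b,i))"
      by (intro sum.cong refl) (simp add: PD)
    also have "\<dots> = (\<Sum>i<n. D $$ (p i,p i) * P $$ (a,p i) * P $$ (b,p i))"
      by (rule sum.reindex_bij_betw[OF p(1), symmetric])
    finally show "A $$ (a,b) = (\<Sum>i<n. sorted_eigenvalues A ! i * ?u i a * ?u i b)"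
      by (simp add: ev)
    show "(\<Sum>i<n. ?u i a * ?u i b) = (if a = b then 1 else 0)"
      using sum.reindex_bij_betw[OF p(1), of "\<lambda>i. P $$ (a,i) * P $$ (b,i)"] PPab[OF ab] by simp
  next
    let ?u = "\<lambda>i a. P $$ (a, p i)"
    fix i j assume ij: "i < n" "j < n"
    have "(P\<^sup>T * P) $$ (p i, p j) = (\<Sum>a<n. ?u i a * ?u j a)"
      using ij pn P(1) by (simp add: scalar_prod_def lessThan_atLeast0)
    moreover have "p i = p j \<longleftrightarrow> i = j"
      using p(1) ij by (auto simp: bij_betw_def inj_on_def)
    ultimately show "(\<Sum>a<n. ?u i a * ?u j a) = (if i = j then 1 else 0)"
      using ij pn by (simp add: P(2))
  qed
qed

section \<open>Underdetermined linear systems\<close>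

text \<open>Gaussian elimination, one equation per induction step. It serves as the dimension count
  in the min-max argument.\<close>

lemma homogeneous_system_nontrivial:
  fixes a :: "'j \<Rightarrow> 'i \<Rightarrow> real"
  assumes "finite J" "finite I" "card J < card I"
  shows "\<exists>c. (\<exists>i\<in>I. c i \<noteq> 0) \<and> (\<forall>j\<in>J. (\<Sum>i\<in>I. c i * a j i) = 0)"
  using assms
proof (induction J arbitrary: I a rule: finite_induct)
  case empty
  then have "I \<noteq> {}" by auto
  then show ?case by (intro exI[of _ "\<lambda>_. 1"]) auto
next
  case (insert j J)
  show ?case
  proof (cases "\<forall>i\<in>I. a j i = 0")
    case True
    have "card J < card I" using insert by simp
    from insert.IH[OF insert.prems(1) this] obtain c where
      "\<exists>i\<in>I. c i \<noteq> 0" "\<forall>j\<in>J. (\<Sum>i\<in>I. c i * a j i) = 0" by blast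
    then show ?thesis using True by (intro exI[of _ c]) auto
  next
    case False
    then obtain p where p: "p \<in> I" "a j p \<noteq> 0" by blast
    \<comment> \<open>The coefficients left after equation \<open>j\<close> has been used to
      eliminate the unknown \<open>p\<close>.\<close>
    define b where "b l i = a l i - a l p / a j p * a j i" for l i
    have "card J < card (I - {p})" using insert p by simp
    with insert.IH[of "I - {p}" b] insert.prems obtain c where
      c: "\<exists>i\<in>I - {p}. c i \<noteq> 0" "\<forall>l\<in>J. (\<Sum>i\<in>I - {p}. c i * b l i) = 0" by auto
    \<comment> \<open>Back substitution: the value at \<open>p\<close> is the one that solves
      equation \<open>j\<close>.\<close>
    define d where "d = c(p := - (\<Sum>i\<in>I - {p}. c i * a j i) / a j p)"
    have d: "(\<Sum>i\<in>I. d i * a l i) = d p * a l p + (\<Sum>i\<in>I - {p}. c i * a l i)" for l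
    proof -
      have "(\<Sum>i\<in>I - {p}. d i * a l i) = (\<Sum>i\<in>I - {p}. c i * a l i)"
        by (intro sum.cong refl) (auto simp: d_def)
      then show ?thesis using sum.remove[OF insert.prems(1) p(1), of "\<lambda>i. d i * a l i"] by simp
    qed
    have "(\<Sum>i\<in>I. d i * a l i) = (\<Sum>i\<in>I - {p}. c i * b l i)" for l
      unfolding d by (simp add: d_def b_def algebra_simps sum_subtractf sum_distrib_left sum_divide_distrib)
    moreover have "(\<Sum>i\<in>I. d i * a j i) = 0"
      unfolding d using p by (simp add: d_def)
    moreover have "\<exists>i\<in>I. d i \<noteq> 0" using c(1) by (auto simp: d_def)
    ultimately show ?thesis using c(2) by auto
  qed
qed

section \<open>Tent functions on a partition of an interval\<close>

text \<open>For \<open>a \<le> b\<close> this is the distance from \<open>x\<close> to the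
  complement of the open interval between \<open>a\<close> and \<open>b\<close>.\<close>

definition tent :: "real \<Rightarrow> real \<Rightarrow> real \<Rightarrow> real" where
  "tent a b x = max 0 (min (x - a) (b - x))"

definition clip :: "real \<Rightarrow> real \<Rightarrow> real \<Rightarrow> real" where
  "clip a b x = max a (min b x)"

text \<open>For \<open>a \<le> b\<close> the closed form of the integral of \<open>tent a b\<close>
  from \<open>a\<close> to \<open>x\<close>; clipping makes it constant outside the
  interval.\<close>

definition tent_integral :: "real \<Rightarrow> real \<Rightarrow> real \<Rightarrow> real" where
  "tent_integral a b x = (let y = clip a b x in
     if y \<le> (a + b) / 2 then (y - a)\<^sup>2 / 2 else (b - a)\<^sup>2 / 4 - (b - y)\<^sup>2 / 2)"

lemma tent_neq_0_iff: "tent a b x \<noteq> 0 \<longleftrightarrow> a < x \<and> x < b"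
  by (auto simp: tent_def)

lemma clip_mono: "y \<le> x \<Longrightarrow> clip a b y \<le> clip a b x"
  by (auto simp: clip_def)

text \<open>The tent is 1-Lipschitz and changes only inside its interval; the clip difference is the
  length of the overlap with the segment from \<open>y\<close> to \<open>x\<close>.\<close>

lemma tent_diff_le: "a \<le> b \<Longrightarrow> y \<le> x \<Longrightarrow> \<bar>tent a b x - tent a b y\<bar> \<le> clip a b x - clip a b y"
  by (auto simp: tent_def clip_def max_def min_def)

text \<open>On the ascending half the constant would be 1/2; over the whole interval it drops to
  1/4, with equality at the right end.\<close>

lemma tent_integral_ge:
  assumes "a \<le> b" shows "tent_integral a b x \<ge> (clip a b x - a)\<^sup>2 / 4"
proof -
  define y where "y = clip a b x"
  have y: "a \<le> y" "y \<le> b" using assms by (auto simp: y_def clip_def)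
  have "(b - a)\<^sup>2 / 4 - (b - y)\<^sup>2 / 2 - (y - a)\<^sup>2 / 4 = (b - y) * (2 * y - a - b) / 2 + (b - y)\<^sup>2 / 4"
    by (simp add: power2_eq_square field_simps)
  moreover have "(b - y) * (2 * y - a - b) \<ge> 0" if "y > (a + b) / 2"
    using y that by (intro mult_nonneg_nonneg) auto
  ultimately have "(y - a)\<^sup>2 / 4 \<le> (b - a)\<^sup>2 / 4 - (b - y)\<^sup>2 / 2" if "y > (a + b) / 2"
    using that zero_le_power2[of "b - y"] by linarith
  then show ?thesis
    unfolding tent_integral_def Let_def y_def[symmetric] by (simp add: not_le)
qed

lemma tent_integral_mono:
  assumes "a \<le> b" "y \<le> x" shows "tent_integral a b y \<le> tent_integral a b x"
proof -
  define p q where "p = clip a b y" and "q = clip a b x"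
  have pq: "a \<le> p" "p \<le> q" "q \<le> b" using assms by (auto simp: p_def q_def clip_def)
  consider "q \<le> (a + b) / 2" | "p \<le> (a + b) / 2" "q > (a + b) / 2" | "p > (a + b) / 2"
    by linarith
  then show ?thesis
  proof cases
    case 1
    then have "(p - a)\<^sup>2 \<le> (q - a)\<^sup>2" using pq by (intro power_mono) auto
    then show ?thesis using 1 pq by (simp add: tent_integral_def flip: p_def q_def)
  next
    case 2
    have "(p - a)\<^sup>2 \<le> ((b - a) / 2)\<^sup>2" "(b - q)\<^sup>2 \<le> ((b - a) / 2)\<^sup>2"
      using pq 2 by (auto intro!: power_mono)
    then show ?thesis using 2 pq
      by (simp add: tent_integral_def power_divide flip: p_def q_def)
  next
    case 3
    then have "(b - q)\<^sup>2 \<le> (b - p)\<^sup>2" using pq by (intro power_mono) auto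
    then show ?thesis using 3 pq by (simp add: tent_integral_def flip: p_def q_def)
  qed
qed

text \<open>A first-order Taylor bound: the derivative is a 1-Lipschitz function, so the error is at
  most \<open>d\<^sup>2 / 2\<close>.\<close>

lemma tent_integral_diff_le:
  assumes "a \<le> b" "y \<le> x"
  defines "d \<equiv> clip a b x - clip a b y"
  shows "tent_integral a b x - tent_integral a b y \<le> d * tent a b y + d\<^sup>2 / 2"
proof -
  define p q where "p = clip a b y" and "q = clip a b x"
  have pq: "a \<le> p" "p \<le> q" "q \<le> b" using assms by (auto simp: p_def q_def clip_def)
  have t: "tent a b y = min (p - a) (b - p) \<or> p = q"
    using assms by (auto simp: p_def q_def clip_def tent_def max_def min_def)
  consider "p = q" | "q \<le> (a + b) / 2" "p < q" | "p \<le> (a + b) / 2" "q > (a + b) / 2" | "p > (a + b) / 2" "p < q"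
    using pq by linarith
  then show ?thesis
  proof cases
    case 1
    then show ?thesis using pq by (simp add: tent_integral_def d_def flip: p_def q_def)
  next
    case 2
    then have "tent a b y = p - a" using t pq by (auto simp: min_def)
    moreover have "(q - a)\<^sup>2 / 2 - (p - a)\<^sup>2 / 2 = (q - p) * (p - a) + (q - p)\<^sup>2 / 2"
      by (simp add: power2_eq_square field_simps)
    ultimately show ?thesis using 2 pq by (simp add: tent_integral_def d_def flip: p_def q_def)
  next
    case 3
    then have "tent a b y = p - a" using t pq by (auto simp: min_def)
    \<comment> \<open>The last square is what the descending half of the tent loses against the
      continued ascending line.\<close>
    moreover have "(b - a)\<^sup>2 / 4 - (b - q)\<^sup>2 / 2 - (p - a)\<^sup>2 / 2 = (q - p) * (p - a) + (q - p)\<^sup>2 / 2 - (q - (a + b) / 2)\<^sup>2"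
      by (simp add: power2_eq_square field_simps)
    ultimately show ?thesis using 3 pq by (simp add: tent_integral_def d_def flip: p_def q_def)
  next
    case 4
    then have "tent a b y = b - p" using t pq by (auto simp: min_def)
    moreover have "(b - p)\<^sup>2 / 2 - (b - q)\<^sup>2 / 2 = (q - p) * (b - p) - (q - p)\<^sup>2 / 2"
      by (simp add: power2_eq_square field_simps)
    moreover have "(q - p)\<^sup>2 \<ge> 0" by simp
    ultimately have "(b - p)\<^sup>2 / 2 - (b - q)\<^sup>2 / 2 \<le> (q - p) * tent a b y + (q - p)\<^sup>2 / 2"
      by simp
    then show ?thesis using 4 pq by (simp add: tent_integral_def d_def flip: p_def q_def)
  qed
qed

text \<open>In this form the sum over consecutive thresholds telescopes.\<close>

lemma clip_minus: "a \<le> b \<Longrightarrow> clip a b x - a = min x b - min x a"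
  unfolding clip_def by linarith

lemma sum_clip:
  assumes mono: "\<And>i. t i \<le> t (Suc i)" and x: "t 0 \<le> x" "x \<le> t m"
  shows "(\<Sum>i<m. clip (t i) (t (Suc i)) x - t i) = x - t 0"
proof -
  have "(\<Sum>i<m. clip (t i) (t (Suc i)) x - t i) = (\<Sum>i<m. min x (t (Suc i)) - min x (t i))"
    by (rule sum.cong) (simp_all only: clip_minus[OF mono])
  also have "\<dots> = min x (t m) - min x (t 0)" using sum_lessThan_telescope[of "\<lambda>i. min x (t i)" m] by simp
  finally show ?thesis using x by (simp add: min_def)
qed

lemma tent_integral_eq_0:
  assumes "x \<le> a" "a \<le> b" shows "tent_integral a b x = 0"
proof -
  have "clip a b x = a" using assms unfolding clip_def by linarith
  moreover have "a \<le> (a + b) / 2" using assms(2) by simp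
  ultimately show ?thesis unfolding tent_integral_def Let_def by simp
qed

lemma sum_squares_le_square_sum:
  fixes d :: "'a \<Rightarrow> real"
  assumes "finite I" "\<And>i. i \<in> I \<Longrightarrow> d i \<ge> 0"
  shows "(\<Sum>i\<in>I. (d i)\<^sup>2) \<le> (\<Sum>i\<in>I. d i)\<^sup>2"
proof -
  have "(\<Sum>i\<in>I. d i * d i) \<le> (\<Sum>i\<in>I. (\<Sum>i\<in>I. d i) * d i)"
    using assms by (intro sum_mono mult_right_mono member_le_sum) auto
  then show ?thesis by (simp add: power2_eq_square sum_distrib_left)
qed

context
  fixes t :: "nat \<Rightarrow> real" and m :: nat
  assumes mono: "\<And>i. t i \<le> t (Suc i)"
begin

lemma
  assumes "t 0 \<le> y" "y \<le> x" "x \<le> t m"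
  shows sum_clip_diff: "(\<Sum>i<m. clip (t i) (t (Suc i)) x - clip (t i) (t (Suc i)) y) = x - y"
    and sum_clip_diff_squares: "(\<Sum>i<m. (clip (t i) (t (Suc i)) x - clip (t i) (t (Suc i)) y)\<^sup>2) \<le> (x - y)\<^sup>2"
proof -
  show 1: "(\<Sum>i<m. clip (t i) (t (Suc i)) x - clip (t i) (t (Suc i)) y) = x - y"
    using sum_clip[of t x m, OF mono] sum_clip[of t y m, OF mono] assms by (simp add: sum_subtractf)
  show "(\<Sum>i<m. (clip (t i) (t (Suc i)) x - clip (t i) (t (Suc i)) y)\<^sup>2) \<le> (x - y)\<^sup>2"
    using sum_squares_le_square_sum[of "{..<m}" "\<lambda>i. clip (t i) (t (Suc i)) x - clip (t i) (t (Suc i)) y"]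
      clip_mono[OF assms(2)] unfolding 1 by simp
qed

text \<open>Each tent changes by at most its overlap with the segment between the two points. The
  overlaps are nonnegative and add up to the length of the segment, so their squares add up to at
  most its square.\<close>

lemma sum_tent_diff_squares:
  assumes "t 0 \<le> x" "x \<le> t m" "t 0 \<le> y" "y \<le> t m"
  shows "(\<Sum>i<m. (tent (t i) (t (Suc i)) x - tent (t i) (t (Suc i)) y)\<^sup>2) \<le> (x - y)\<^sup>2"
proof -
  have *: "(\<Sum>i<m. (tent (t i) (t (Suc i)) x - tent (t i) (t (Suc i)) y)\<^sup>2) \<le> (x - y)\<^sup>2"
    if "y \<le> x" "t 0 \<le> y" "x \<le> t m" for x y
  proof -
    have "(\<Sum>i<m. (tent (t i) (t (Suc i)) x - tent (t i) (t (Suc i)) y)\<^sup>2)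
        \<le> (\<Sum>i<m. (clip (t i) (t (Suc i)) x - clip (t i) (t (Suc i)) y)\<^sup>2)"
    proof (rule sum_mono)
      fix i show "(tent (t i) (t (Suc i)) x - tent (t i) (t (Suc i)) y)\<^sup>2
          \<le> (clip (t i) (t (Suc i)) x - clip (t i) (t (Suc i)) y)\<^sup>2"
        using tent_diff_le[OF mono that(1), of i] by (intro power2_le_iff_abs_le[THEN iffD2]) auto
    qed
    also have "\<dots> \<le> (x - y)\<^sup>2" using sum_clip_diff_squares that by blast
    finally show ?thesis .
  qed
  show ?thesis
    using *[of y x] *[of x y] assms by (cases "y \<le> x") (auto simp: power2_commute)
qed

text \<open>Cauchy-Schwarz over the \<open>m\<close> pieces into which the thresholds cut
  \<open>x - t 0\<close>; the factor \<open>m\<close> is the price of the number of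
  thresholds.\<close>

lemma sum_tent_integral_ge:
  assumes "t 0 \<le> x" "x \<le> t m"
  shows "(x - t 0)\<^sup>2 \<le> 4 * real m * (\<Sum>i<m. tent_integral (t i) (t (Suc i)) x)"
proof -
  have "(x - t 0)\<^sup>2 = (\<Sum>i<m. clip (t i) (t (Suc i)) x - t i)\<^sup>2"
    using sum_clip[of t, OF mono assms] by simp
  also have "\<dots> \<le> real m * (\<Sum>i<m. (clip (t i) (t (Suc i)) x - t i)\<^sup>2)"
    using sum_squared_le_sum_of_squares[of "\<lambda>i. clip (t i) (t (Suc i)) x - t i" "{..<m}"]
    by (simp add: mult.commute)
  also have "\<dots> \<le> real m * (\<Sum>i<m. 4 * tent_integral (t i) (t (Suc i)) x)"
  proof (intro mult_left_mono sum_mono)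
    fix i show "(clip (t i) (t (Suc i)) x - t i)\<^sup>2 \<le> 4 * tent_integral (t i) (t (Suc i)) x"
      using tent_integral_ge[OF mono, of i x] by simp
  qed simp
  finally show ?thesis by (simp add: mult_ac flip: sum_distrib_left)
qed

text \<open>At most one tent is nonzero at \<open>y\<close>, so the square root is the distance from
  \<open>y\<close> to the nearest threshold. Writing it this way lets its squared norm split into a
  sum over tents later.\<close>

lemma sum_tent_integral_diff_le:
  assumes "t 0 \<le> y" "y \<le> x" "x \<le> t m"
  defines "H \<equiv> \<lambda>x. \<Sum>i<m. tent_integral (t i) (t (Suc i)) x"
  shows "\<bar>H x - H y\<bar> \<le> (x - y) * sqrt (\<Sum>i<m. (tent (t i) (t (Suc i)) y)\<^sup>2) + (x - y)\<^sup>2 / 2"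
proof -
  let ?r = "sqrt (\<Sum>i<m. (tent (t i) (t (Suc i)) y)\<^sup>2)"
  let ?d = "\<lambda>i. clip (t i) (t (Suc i)) x - clip (t i) (t (Suc i)) y"
  have "H x - H y = (\<Sum>i<m. tent_integral (t i) (t (Suc i)) x - tent_integral (t i) (t (Suc i)) y)"
    by (simp add: H_def sum_subtractf)
  also have "\<dots> \<le> (\<Sum>i<m. ?d i * ?r + (?d i)\<^sup>2 / 2)"
  proof (rule sum_mono)
    fix i assume i: "i \<in> {..<m}"
    have "(tent (t i) (t (Suc i)) y)\<^sup>2 \<le> (\<Sum>i<m. (tent (t i) (t (Suc i)) y)\<^sup>2)"
      using i by (intro member_le_sum) auto
    then have "tent (t i) (t (Suc i)) y \<le> ?r" by (rule real_le_rsqrt)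
    then have "?d i * tent (t i) (t (Suc i)) y \<le> ?d i * ?r"
      using clip_mono[OF assms(2)] by (intro mult_left_mono) auto
    then show "tent_integral (t i) (t (Suc i)) x - tent_integral (t i) (t (Suc i)) y \<le> ?d i * ?r + (?d i)\<^sup>2 / 2"
      using tent_integral_diff_le[OF mono assms(2), of i] by linarith
  qed
  also have "\<dots> = (\<Sum>i<m. ?d i) * ?r + (\<Sum>i<m. (?d i)\<^sup>2) / 2"
    by (simp add: sum.distrib sum_distrib_right sum_divide_distrib)
  also have "\<dots> \<le> (x - y) * ?r + (x - y)\<^sup>2 / 2"
    using sum_clip_diff[OF assms(1-3)] sum_clip_diff_squares[OF assms(1-3)] by simp
  finally have "H x - H y \<le> (x - y) * ?r + (x - y)\<^sup>2 / 2" .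
  moreover have "H y \<le> H x"
    unfolding H_def by (intro sum_mono tent_integral_mono mono assms)
  ultimately show ?thesis by simp
qed

end

section \<open>Greedy choice of thresholds\<close>

text \<open>From each threshold the right end moves until the tent has weight exactly
  \<open>c\<close>, by the intermediate value theorem, or until \<open>M\<close> is reached. From
  then on all thresholds equal \<open>M\<close>.\<close>

lemma tent_thresholds_exist:
  fixes d f :: "'a \<Rightarrow> real" and V :: "'a set"
  assumes M: "0 \<le> M" and c: "0 \<le> c"
  defines "G \<equiv> \<lambda>a b. \<Sum>v\<in>V. d v * (tent a b (f v))\<^sup>2"
  obtains t :: "nat \<Rightarrow> real" where "t 0 = 0" "\<And>i. t i \<le> t (Suc i)" "\<And>i. t i \<le> M"
    "\<And>i. G (t i) (t (Suc i)) \<le> c" "\<And>i. G (t i) (t (Suc i)) = c \<or> t (Suc i) = M"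
proof -
  have step: "\<exists>b. a \<le> b \<and> b \<le> M \<and> G a b \<le> c \<and> (G a b = c \<or> b = M)" if a: "a \<le> M" for a
  proof (cases "G a M \<le> c")
    case False
    have "G a a = 0" by (auto simp: G_def tent_def intro!: sum.neutral)
    moreover have "continuous_on {a..M} (G a)"
      unfolding G_def tent_def by (intro continuous_intros)
    ultimately obtain b where "a \<le> b" "b \<le> M" "G a b = c"
      using IVT'[of "G a" a c M] a c False by auto
    then show ?thesis by auto
  qed (use a in auto)
  have "\<exists>t. \<forall>i. ((i = 0 \<longrightarrow> t i = 0) \<and> t i \<le> M) \<and>
      (t i \<le> t (Suc i) \<and> G (t i) (t (Suc i)) \<le> c \<and> (G (t i) (t (Suc i)) = c \<or> t (Suc i) = M))"
  proof (rule dependent_nat_choice)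
    show "\<exists>x. ((0::nat) = 0 \<longrightarrow> x = 0) \<and> x \<le> M" using M by auto
    fix x and i :: nat assume "(i = 0 \<longrightarrow> x = 0) \<and> x \<le> M"
    then show "\<exists>y. ((Suc i = 0 \<longrightarrow> y = 0) \<and> y \<le> M) \<and>
        (x \<le> y \<and> G x y \<le> c \<and> (G x y = c \<or> y = M))"
      using step[of x] by auto
  qed
  then obtain t where "\<forall>i. ((i = 0 \<longrightarrow> t i = 0) \<and> t i \<le> M) \<and>
      (t i \<le> t (Suc i) \<and> G (t i) (t (Suc i)) \<le> c \<and> (G (t i) (t (Suc i)) = c \<or> t (Suc i) = M))"
    by blast
  then show thesis by (intro that[of t]) auto
qed

section \<open>Energy and conductance of weighted graphs\<close>

lemma sum_swap3:
  "(\<Sum>i\<in>A. \<Sum>a\<in>B. \<Sum>b\<in>C. g i a b) = (\<Sum>a\<in>B. \<Sum>b\<in>C. \<Sum>i\<in>A. g i a b)"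
  by (subst sum.swap) (intro sum.cong refl sum.swap)

text \<open>The quadratic form of the unnormalized Laplacian \<open>D - A\<close>; the division by 2
  compensates for summing over ordered pairs.\<close>

definition energy :: "nat \<Rightarrow> (nat \<Rightarrow> nat \<Rightarrow> real) \<Rightarrow> (nat \<Rightarrow> real) \<Rightarrow> real" where
  "energy n w f = (\<Sum>u<n. \<Sum>v<n. w u v * (f u - f v)\<^sup>2) / 2"

text \<open>The squared norm of \<open>D^(1/2) f\<close>, hence the denominator of the Rayleigh
  quotient whose numerator is \<open>energy\<close>.\<close>

definition sqnorm :: "nat \<Rightarrow> (nat \<Rightarrow> nat \<Rightarrow> real) \<Rightarrow> (nat \<Rightarrow> real) \<Rightarrow> real" where
  "sqnorm n w f = (\<Sum>v<n. wdeg n w v * (f v)\<^sup>2)"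

locale weighted_graph =
  fixes n :: nat and w :: "nat \<Rightarrow> nat \<Rightarrow> real"
  assumes weight_sym: "u < n \<Longrightarrow> v < n \<Longrightarrow> w u v = w v u"
    and weight_nonneg: "u < n \<Longrightarrow> v < n \<Longrightarrow> w u v \<ge> 0"
    and deg_pos: "v < n \<Longrightarrow> wdeg n w v > 0"
begin

lemma sum_weight_sym: "(\<Sum>u<n. \<Sum>v<n. w u v * g u v) = (\<Sum>u<n. \<Sum>v<n. w u v * g v u)"
proof -
  have "(\<Sum>u<n. \<Sum>v<n. w u v * g u v) = (\<Sum>v<n. \<Sum>u<n. w u v * g u v)" by (rule sum.swap)
  also have "\<dots> = (\<Sum>u<n. \<Sum>v<n. w u v * g v u)"
    by (intro sum.cong refl) (simp add: weight_sym)
  finally show ?thesis .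
qed

lemma sum_weight_fst: "(\<Sum>u<n. \<Sum>v<n. w u v * g u) = (\<Sum>u<n. wdeg n w u * g u)"
  by (simp add: wdeg_def sum_distrib_right)

lemma sum_weight_snd: "(\<Sum>u<n. \<Sum>v<n. w u v * g v) = (\<Sum>u<n. wdeg n w u * g u)"
  using sum_weight_sym[of "\<lambda>u v. g v"] by (simp add: sum_weight_fst)

lemma sum_weight_mono:
  assumes "\<And>u v. u < n \<Longrightarrow> v < n \<Longrightarrow> g u v \<le> h u v"
  shows "(\<Sum>u<n. \<Sum>v<n. w u v * g u v) \<le> (\<Sum>u<n. \<Sum>v<n. w u v * h u v)"
  by (intro sum_mono mult_left_mono) (use assms weight_nonneg in auto)

lemma energy_nonneg: "energy n w f \<ge> 0"
  unfolding energy_def by (intro divide_nonneg_pos sum_nonneg mult_nonneg_nonneg) (auto simp: weight_nonneg)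

lemma energy_eq: "energy n w f = sqnorm n w f - (\<Sum>u<n. \<Sum>v<n. w u v * (f u * f v))"
proof -
  have "(\<Sum>u<n. \<Sum>v<n. w u v * (f u - f v)\<^sup>2) = (\<Sum>u<n. \<Sum>v<n. w u v * (f u)\<^sup>2)
      + (\<Sum>u<n. \<Sum>v<n. w u v * (f v)\<^sup>2) - 2 * (\<Sum>u<n. \<Sum>v<n. w u v * (f u * f v))"
    unfolding sum_distrib_left sum.distrib[symmetric] sum_subtractf[symmetric]
    by (intro sum.cong refl) (simp add: power2_eq_square algebra_simps)
  then show ?thesis by (simp add: energy_def sqnorm_def sum_weight_fst sum_weight_snd)
qed

text \<open>Follows from \<open>(f u + f v)\<^sup>2 \<ge> 0\<close>; it is what bounds every
  eigenvalue by 2.\<close>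

lemma energy_le_sqnorm: "energy n w f \<le> 2 * sqnorm n w f"
proof -
  have "(\<Sum>u<n. \<Sum>v<n. w u v * (- (f u * f v))) \<le> (\<Sum>u<n. \<Sum>v<n. w u v * ((f u)\<^sup>2 / 2 + (f v)\<^sup>2 / 2))"
  proof (rule sum_weight_mono)
    fix u v show "- (f u * f v) \<le> (f u)\<^sup>2 / 2 + (f v)\<^sup>2 / 2"
      using zero_le_power2[of "f u + f v"] by (simp add: power2_sum)
  qed
  also have "\<dots> = sqnorm n w f"
    using sum_weight_fst[of "\<lambda>u. (f u)\<^sup>2 / 2"] sum_weight_snd[of "\<lambda>u. (f u)\<^sup>2 / 2"]
    by (simp add: distrib_left sum.distrib sqnorm_def flip: sum_divide_distrib)
  finally show ?thesis by (simp add: energy_eq sum_negf)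
qed

section \<open>Spectrum of the normalized Laplacian\<close>

abbreviation "sdeg v \<equiv> sqrt (wdeg n w v)"

lemma sdeg_pos: "v < n \<Longrightarrow> sdeg v > 0"
  by (simp add: deg_pos)

lemma sdeg_sq: "v < n \<Longrightarrow> sdeg v * sdeg v = wdeg n w v"
  using deg_pos[of v] by simp

lemma deg_div_sdeg:
  assumes "v < n" shows "wdeg n w v * (x / sdeg v) = sdeg v * x"
proof -
  have "s * s * (x / s) = s * x" if "s > 0" for s using that by simp
  from this[OF sdeg_pos[OF assms]] show ?thesis unfolding sdeg_sq[OF assms] .
qed

abbreviation "L \<equiv> norm_laplacian n w"

text \<open>Indices start at \<open>0\<close> here: \<open>ev i\<close> is \<open>\<lambda>\<^sub>i\<^sub>+\<^sub>1\<close>.\<close>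

abbreviation "ev i \<equiv> sorted_eigenvalues L ! i"

lemma L_carrier: "L \<in> carrier_mat n n"
  by (simp add: norm_laplacian_def)

lemma L_sym: "L\<^sup>T = L"
  by (rule eq_matI) (auto simp: norm_laplacian_def weight_sym)

text \<open>The substitution \<open>x = D^(1/2) f\<close> turns the form of the normalized Laplacian
  into that of \<open>D - A\<close>.\<close>

lemma L_quadratic_form:
  "(\<Sum>a<n. \<Sum>b<n. L $$ (a,b) * (sdeg a * f a) * (sdeg b * f b)) = energy n w f"
proof -
  have "(\<Sum>a<n. \<Sum>b<n. L $$ (a,b) * (sdeg a * f a) * (sdeg b * f b)) =
      (\<Sum>a<n. \<Sum>b<n. (if a = b then wdeg n w b * (f b)\<^sup>2 else 0) - w a b * (f a * f b))"
  proof (intro sum.cong refl)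
    fix a b assume "a \<in> {..<n}" "b \<in> {..<n}"
    then have ab: "a < n" "b < n" by auto
    have "w a b / (sdeg a * sdeg b) * (sdeg a * f a) * (sdeg b * f b) = w a b * (f a * f b)"
      using sdeg_pos[OF ab(1)] sdeg_pos[OF ab(2)] by (simp add: field_simps)
    moreover have "(if a = b then 1 else 0) * (sdeg a * f a) * (sdeg b * f b)
        = (if a = b then wdeg n w b * (f b)\<^sup>2 else 0)"
    proof -
      have "(sdeg b * f b) * (sdeg b * f b) = wdeg n w b * (f b)\<^sup>2"
        unfolding sdeg_sq[OF ab(2), THEN arg_cong[where f = "\<lambda>d. d * (f b)\<^sup>2"], symmetric]
        by (simp only: power2_eq_square mult_ac)
      then show ?thesis by simp
    qed
    ultimately show "L $$ (a,b) * (sdeg a * f a) * (sdeg b * f b)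
        = (if a = b then wdeg n w b * (f b)\<^sup>2 else 0) - w a b * (f a * f b)"
      using ab by (simp only: norm_laplacian_def index_mat left_diff_distrib prod.case)
  qed
  also have "\<dots> = energy n w f"
    unfolding energy_eq sqnorm_def sum_subtractf
    by (intro arg_cong2[where f = minus] sum.cong refl) auto
  finally show ?thesis .
qed

text \<open>\<open>u i a\<close> is entry \<open>a\<close> of the eigenvector for
  \<open>ev i\<close>. The clauses are the spectral decomposition, completeness (used for Parseval)
  and orthonormality.\<close>

definition eigenbasis :: "(nat \<Rightarrow> nat \<Rightarrow> real) \<Rightarrow> bool" where
  "eigenbasis u \<longleftrightarrow>
    (\<forall>a<n. \<forall>b<n. L $$ (a,b) = (\<Sum>i<n. ev i * u i a * u i b)) \<and>
    (\<forall>a<n. \<forall>b<n. (\<Sum>i<n. u i a * u i b) = (if a = b then 1 else 0)) \<and>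
    (\<forall>i<n. \<forall>j<n. (\<Sum>a<n. u i a * u j a) = (if i = j then 1 else 0))"

lemma eigenbasis_exists: "\<exists>u. eigenbasis u"
proof (rule symmetric_mat_spectral[OF L_carrier L_sym])
  fix u
  assume "\<And>a b. a < n \<Longrightarrow> b < n \<Longrightarrow> L $$ (a,b) = (\<Sum>i<n. ev i * u i a * u i b)"
    "\<And>a b. a < n \<Longrightarrow> b < n \<Longrightarrow> (\<Sum>i<n. u i a * u i b) = (if a = b then 1 else 0)"
    "\<And>i j. i < n \<Longrightarrow> j < n \<Longrightarrow> (\<Sum>a<n. u i a * u j a) = (if i = j then 1 else 0)"
  then have "eigenbasis u" unfolding eigenbasis_def by blast
  then show "\<exists>u. eigenbasis u" by blast
qed

lemma ev_mono: "i \<le> j \<Longrightarrow> j < n \<Longrightarrow> ev i \<le> ev j"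
  by (rule symmetric_mat_spectral[OF L_carrier L_sym]) (simp add: sorted_nth_mono)

text \<open>The coordinates of \<open>D\<^sup>1\<^sup>/\<^sup>2 f\<close>.\<close>

definition coord :: "(nat \<Rightarrow> nat \<Rightarrow> real) \<Rightarrow> (nat \<Rightarrow> real) \<Rightarrow> nat \<Rightarrow> real" where
  "coord u f i = (\<Sum>a<n. sdeg a * f a * u i a)"

lemma coord_square: "(coord u f i)\<^sup>2 = (\<Sum>a<n. \<Sum>b<n. u i a * u i b * (sdeg a * f a) * (sdeg b * f b))"
  unfolding coord_def power2_eq_square sum_product by (intro sum.cong refl) simp

lemma sqnorm_eq_coords:
  assumes "eigenbasis u"
  shows "sqnorm n w f = (\<Sum>i<n. (coord u f i)\<^sup>2)"
proof -
  have "(\<Sum>i<n. (coord u f i)\<^sup>2) =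
      (\<Sum>a<n. \<Sum>b<n. (\<Sum>i<n. u i a * u i b) * (sdeg a * f a) * (sdeg b * f b))"
    unfolding coord_square sum_distrib_right by (rule sum_swap3)
  also have "\<dots> = (\<Sum>a<n. \<Sum>b<n. if a = b then wdeg n w b * (f b)\<^sup>2 else 0)"
    using assms sdeg_sq by (intro sum.cong refl) (auto simp: eigenbasis_def power2_eq_square mult_ac)
  also have "\<dots> = sqnorm n w f" by (simp add: sqnorm_def)
  finally show ?thesis by simp
qed

lemma energy_eq_coords:
  assumes "eigenbasis u"
  shows "energy n w f = (\<Sum>i<n. ev i * (coord u f i)\<^sup>2)"
proof -
  have "(\<Sum>i<n. ev i * (coord u f i)\<^sup>2) =
      (\<Sum>a<n. \<Sum>b<n. (\<Sum>i<n. ev i * u i a * u i b) * (sdeg a * f a) * (sdeg b * f b))"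
    unfolding coord_square sum_distrib_right sum_distrib_left by (subst sum_swap3) (simp add: mult_ac)
  also have "\<dots> = (\<Sum>a<n. \<Sum>b<n. L $$ (a,b) * (sdeg a * f a) * (sdeg b * f b))"
    using assms by (intro sum.cong refl) (auto simp: eigenbasis_def)
  finally show ?thesis by (simp add: L_quadratic_form)
qed

lemma coord_eigenvector:
  assumes "eigenbasis u" "i < n" "j < n"
  shows "coord u (\<lambda>a. u i a / sdeg a) j = (if i = j then 1 else 0)"
proof -
  have "coord u (\<lambda>a. u i a / sdeg a) j = (\<Sum>a<n. u i a * u j a)"
    unfolding coord_def by (intro sum.cong refl) (use deg_pos in force)
  then show ?thesis using assms by (simp add: eigenbasis_def)
qed

text \<open>The test function \<open>D^(-1/2) u i\<close> has norm 1 and energy \<open>ev i\<close>,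
  so both bounds are bounds on energies.\<close>

lemma
  assumes "i < n"
  shows ev_nonneg: "0 \<le> ev i" and ev_le_2: "ev i \<le> 2"
proof -
  obtain u where u: "eigenbasis u" using eigenbasis_exists by blast
  let ?f = "\<lambda>a. u i a / sdeg a"
  have "energy n w ?f = (\<Sum>j<n. if i = j then ev i else 0)"
    unfolding energy_eq_coords[OF u] by (intro sum.cong refl) (auto simp: coord_eigenvector[OF u assms])
  then have e: "energy n w ?f = ev i" using assms by simp
  have "sqnorm n w ?f = (\<Sum>j<n. if i = j then 1 else 0)"
    unfolding sqnorm_eq_coords[OF u] by (intro sum.cong refl) (auto simp: coord_eigenvector[OF u assms])
  then have "sqnorm n w ?f = 1" using assms by simp
  then show "0 \<le> ev i" "ev i \<le> 2"
    using e energy_nonneg[of ?f] energy_le_sqnorm[of ?f] by simp_all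
qed

text \<open>The factor 2 comes from edges joining two different supports.\<close>

lemma ev_le_disjoint_supports:
  assumes fin: "finite I" and k: "k < n" "k < card I"
    and disj: "\<And>i j v. i \<in> I \<Longrightarrow> j \<in> I \<Longrightarrow> v < n \<Longrightarrow> F i v \<noteq> 0 \<Longrightarrow> F j v \<noteq> 0 \<Longrightarrow> i = j"
    and norm: "\<And>i. i \<in> I \<Longrightarrow> sqnorm n w (F i) \<ge> c"
    and energy: "\<And>i. i \<in> I \<Longrightarrow> energy n w (F i) \<le> e"
  shows "ev k * c \<le> 2 * e"
proof -
  obtain u where u: "eigenbasis u" using eigenbasis_exists by blast
  \<comment> \<open>With more functions than the \<open>k\<close> conditions, some nontrivial
    combination is orthogonal to the first \<open>k\<close> eigenvectors; its Rayleigh quotient is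
    then at least \<open>ev k\<close>.\<close>
  from homogeneous_system_nontrivial[of "{..<k}" I "\<lambda>j i. coord u (F i) j"]
  obtain x where x: "\<exists>i\<in>I. x i \<noteq> 0" "\<And>j. j < k \<Longrightarrow> (\<Sum>i\<in>I. x i * coord u (F i) j) = 0"
    using fin k by auto
  define y where "y v = (\<Sum>i\<in>I. x i * F i v)" for v
  have coord_y: "coord u y j = (\<Sum>i\<in>I. x i * coord u (F i) j)" for j
    unfolding y_def coord_def sum_distrib_left sum_distrib_right
    by (subst sum.swap) (simp add: mult_ac)
  have "ev k * sqnorm n w y \<le> energy n w y"
    unfolding sqnorm_eq_coords[OF u] energy_eq_coords[OF u] sum_distrib_left
  proof (rule sum_mono)
    fix j assume j: "j \<in> {..<n}"
    show "ev k * (coord u y j)\<^sup>2 \<le> ev j * (coord u y j)\<^sup>2"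
    proof (cases "j < k")
      case True
      then show ?thesis using x(2) by (simp add: coord_y)
    next
      case False
      then show ?thesis using ev_mono[of k j] j by (intro mult_right_mono) auto
    qed
  qed
  moreover have "sqnorm n w y = (\<Sum>i\<in>I. (x i)\<^sup>2 * sqnorm n w (F i))"
  proof -
    \<comment> \<open>At most one \<open>F i\<close> is nonzero at \<open>v\<close>, so there are no
      cross terms.\<close>
    have "(y v)\<^sup>2 = (\<Sum>i\<in>I. (x i)\<^sup>2 * (F i v)\<^sup>2)" if v: "v < n" for v
    proof (cases "\<exists>p\<in>I. F p v \<noteq> 0")
      case True
      then obtain p where p: "p \<in> I" "F p v \<noteq> 0" by blast
      then have 0: "F i v = 0" if "i \<in> I - {p}" for i using disj v that by blast
      have "y v = x p * F p v" "(\<Sum>i\<in>I. (x i)\<^sup>2 * (F i v)\<^sup>2) = (x p)\<^sup>2 * (F p v)\<^sup>2"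
        unfolding y_def using 0 by (simp_all add: sum.remove[OF fin p(1)])
      then show ?thesis by (simp add: power_mult_distrib)
    qed (auto simp: y_def)
    then have "sqnorm n w y = (\<Sum>v<n. \<Sum>i\<in>I. wdeg n w v * ((x i)\<^sup>2 * (F i v)\<^sup>2))"
      by (simp add: sqnorm_def sum_distrib_left)
    also have "\<dots> = (\<Sum>i\<in>I. (x i)\<^sup>2 * sqnorm n w (F i))"
      unfolding sqnorm_def sum_distrib_left by (subst sum.swap) (simp add: mult_ac)
    finally show ?thesis .
  qed
  moreover have "energy n w y \<le> 2 * (\<Sum>i\<in>I. (x i)\<^sup>2 * energy n w (F i))"
  proof -
    have "(y a - y b)\<^sup>2 \<le> (\<Sum>i\<in>I. 2 * (x i)\<^sup>2 * (F i a - F i b)\<^sup>2)" if ab: "a < n" "b < n" for a b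
    proof -
      define S where "S = {i \<in> I. F i a \<noteq> 0 \<or> F i b \<noteq> 0}"
      \<comment> \<open>Each of the two vertices lies in at most one support, so Cauchy-Schwarz over
        \<open>S\<close> costs only a factor 2.\<close>
      have "card S \<le> 2"
      proof -
        have one: "card {i \<in> I. F i v \<noteq> 0} \<le> Suc 0" if "v < n" for v
        proof -
          have fin': "finite {i \<in> I. F i v \<noteq> 0}" using fin by simp
          show ?thesis
            unfolding card_le_Suc0_iff_eq[OF fin'] using disj[OF _ _ that] by blast
        qed
        have "card {i \<in> I. F i a \<noteq> 0} + card {i \<in> I. F i b \<noteq> 0} \<le> 2"
          using one[OF ab(1)] one[OF ab(2)] by linarith
        moreover have "S = {i \<in> I. F i a \<noteq> 0} \<union> {i \<in> I. F i b \<noteq> 0}" by (auto simp: S_def)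
        ultimately show ?thesis
          using card_Un_le[of "{i \<in> I. F i a \<noteq> 0}" "{i \<in> I. F i b \<noteq> 0}"] by simp
      qed
      have S: "finite S" "S \<subseteq> I" using fin by (auto simp: S_def)
      have "y a - y b = (\<Sum>i\<in>I. x i * (F i a - F i b))"
        by (simp add: y_def sum_subtractf algebra_simps)
      also have "\<dots> = (\<Sum>i\<in>S. x i * (F i a - F i b))"
        by (rule sum.mono_neutral_right) (use fin in \<open>auto simp: S_def\<close>)
      finally have "(y a - y b)\<^sup>2 \<le> (\<Sum>i\<in>S. (x i * (F i a - F i b))\<^sup>2) * card S"
        using sum_squared_le_sum_of_squares[of "\<lambda>i. x i * (F i a - F i b)" S] by simp
      also have "\<dots> \<le> (\<Sum>i\<in>S. (x i * (F i a - F i b))\<^sup>2) * 2"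
        using \<open>card S \<le> 2\<close> by (intro mult_left_mono sum_nonneg) auto
      also have "\<dots> \<le> (\<Sum>i\<in>I. (x i * (F i a - F i b))\<^sup>2) * 2"
        using S fin by (intro mult_right_mono sum_mono2) auto
      also have "\<dots> = (\<Sum>i\<in>I. 2 * (x i)\<^sup>2 * (F i a - F i b)\<^sup>2)"
        by (simp add: sum_distrib_left power_mult_distrib mult_ac)
      finally show ?thesis .
    qed
    then have "energy n w y \<le> (\<Sum>a<n. \<Sum>b<n. w a b * (\<Sum>i\<in>I. 2 * (x i)\<^sup>2 * (F i a - F i b)\<^sup>2)) / 2"
      unfolding energy_def by (intro divide_right_mono sum_weight_mono) auto
    also have "\<dots> = 2 * (\<Sum>i\<in>I. (x i)\<^sup>2 * energy n w (F i))"
    proof -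
      have "(\<Sum>a<n. \<Sum>b<n. w a b * (\<Sum>i\<in>I. 2 * (x i)\<^sup>2 * (F i a - F i b)\<^sup>2)) =
          (\<Sum>a<n. \<Sum>i\<in>I. \<Sum>b<n. w a b * (2 * (x i)\<^sup>2 * (F i a - F i b)\<^sup>2))"
        unfolding sum_distrib_left by (intro sum.cong refl, rule sum.swap)
      also have "\<dots> = (\<Sum>i\<in>I. \<Sum>a<n. \<Sum>b<n. w a b * (2 * (x i)\<^sup>2 * (F i a - F i b)\<^sup>2))"
        by (rule sum.swap)
      also have "\<dots> = (\<Sum>i\<in>I. 4 * ((x i)\<^sup>2 * energy n w (F i)))"
        unfolding energy_def by (intro sum.cong refl) (simp add: sum_distrib_left mult_ac)
      finally show ?thesis by (simp flip: sum_distrib_left)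
    qed
    finally show ?thesis .
  qed
  moreover have "(\<Sum>i\<in>I. (x i)\<^sup>2 * energy n w (F i)) \<le> (\<Sum>i\<in>I. (x i)\<^sup>2) * e"
    unfolding sum_distrib_right using energy by (intro sum_mono mult_left_mono) auto
  moreover have "(\<Sum>i\<in>I. (x i)\<^sup>2) * c \<le> (\<Sum>i\<in>I. (x i)\<^sup>2 * sqnorm n w (F i))"
    unfolding sum_distrib_right using norm by (intro sum_mono mult_left_mono) auto
  then have "ev k * ((\<Sum>i\<in>I. (x i)\<^sup>2) * c) \<le> ev k * (\<Sum>i\<in>I. (x i)\<^sup>2 * sqnorm n w (F i))"
    using ev_nonneg[OF k(1)] by (rule mult_left_mono)
  ultimately have "(\<Sum>i\<in>I. (x i)\<^sup>2) * (ev k * c) \<le> (\<Sum>i\<in>I. (x i)\<^sup>2) * (2 * e)"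
    by (simp add: mult_ac)
  moreover have "(\<Sum>i\<in>I. (x i)\<^sup>2) > 0"
    using x(1) fin by (auto intro!: sum_pos2)
  ultimately show ?thesis by simp
qed

section \<open>Test functions from the second eigenvector\<close>

text \<open>In terms of \<open>g = D^(-1/2) y\<close> the eigenvector equation reads
  \<open>(D - A) g = l D g\<close>, which is a condition on edge differences.\<close>

lemma eigenvector_equation:
  assumes y: "\<And>a. a < n \<Longrightarrow> (\<Sum>b<n. L $$ (a,b) * y b) = l * y a" and a: "a < n"
  shows "(\<Sum>b<n. w a b * (y a / sdeg a - y b / sdeg b)) = l * wdeg n w a * (y a / sdeg a)"
proof -
  have "(\<Sum>b<n. L $$ (a,b) * y b) = (\<Sum>b<n. (if a = b then y b else 0) - w a b * (y b / sdeg b) / sdeg a)"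
    using a by (intro sum.cong refl) (auto simp: norm_laplacian_def field_simps)
  also have "\<dots> = y a - (\<Sum>b<n. w a b * (y b / sdeg b)) / sdeg a"
    using a by (simp add: sum_subtractf sum_divide_distrib)
  finally have "sdeg a * (l * y a) = sdeg a * (y a - (\<Sum>b<n. w a b * (y b / sdeg b)) / sdeg a)"
    using y[OF a] by simp
  also have "\<dots> = sdeg a * y a - (\<Sum>b<n. w a b * (y b / sdeg b))"
    using sdeg_pos[OF a] by (simp add: right_diff_distrib)
  finally have 1: "(\<Sum>b<n. w a b * (y b / sdeg b)) = sdeg a * y a - l * (sdeg a * y a)"
    by (simp add: mult_ac)
  have 2: "wdeg n w a * (y a / sdeg a) = sdeg a * y a"
    by (rule deg_div_sdeg[OF a])
  have 3: "(\<Sum>b<n. w a b * (y a / sdeg a - y b / sdeg b)) = wdeg n w a * (y a / sdeg a) - (\<Sum>b<n. w a b * (y b / sdeg b))"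
    by (simp only: right_diff_distrib sum_subtractf wdeg_def sum_distrib_right)
  show ?thesis unfolding mult.assoc 3 2 1 by simp
qed

text \<open>If \<open>0\<close> is a multiple eigenvalue, the second basis vector need not be orthogonal to the
  degree vector, so a combination of the first two is taken instead.\<close>

lemma second_eigenvector:
  assumes n: "2 \<le> n"
  obtains g where "\<And>a. a < n \<Longrightarrow> (\<Sum>b<n. w a b * (g a - g b)) = ev 1 * wdeg n w a * g a"
    "(\<Sum>a<n. wdeg n w a * g a) = 0" "\<exists>a<n. g a \<noteq> 0"
proof -
  obtain u where u: "eigenbasis u" using eigenbasis_exists by blast
  have eig: "(\<Sum>b<n. L $$ (a,b) * u j b) = ev j * u j a" if "a < n" "j < n" for a j
  proof -
    have "(\<Sum>b<n. L $$ (a,b) * u j b) = (\<Sum>b<n. \<Sum>i<n. ev i * u i a * (u i b * u j b))"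
      using u that by (intro sum.cong refl) (simp add: eigenbasis_def sum_distrib_right sum_distrib_left mult_ac)
    also have "\<dots> = (\<Sum>i<n. \<Sum>b<n. ev i * u i a * (u i b * u j b))" by (rule sum.swap)
    also have "\<dots> = (\<Sum>i<n. if i = j then ev j * u j a else 0)"
      using u that by (intro sum.cong refl) (auto simp: eigenbasis_def simp flip: sum_distrib_left)
    finally show ?thesis using that by simp
  qed
  note result = that
  \<comment> \<open>It suffices to find an eigenvector for \<open>ev 1\<close> that is orthogonal to
    \<open>sdeg\<close>; a nonzero coordinate certifies that it is nonzero.\<close>
  have step: thesis if y: "\<And>a. a < n \<Longrightarrow> (\<Sum>b<n. L $$ (a,b) * y b) = ev 1 * y a"
    "(\<Sum>a<n. sdeg a * y a) = 0" "j < n" "(\<Sum>a<n. y a * u j a) \<noteq> 0" for y j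
  proof (rule result[of "\<lambda>a. y a / sdeg a"])
    show "(\<Sum>b<n. w a b * (y a / sdeg a - y b / sdeg b)) = ev 1 * wdeg n w a * (y a / sdeg a)" if "a < n" for a
      using eigenvector_equation[OF y(1) that] .
    have "(\<Sum>a<n. wdeg n w a * (y a / sdeg a)) = (\<Sum>a<n. sdeg a * y a)"
      by (intro sum.cong refl) (simp only: lessThan_iff deg_div_sdeg)
    then show "(\<Sum>a<n. wdeg n w a * (y a / sdeg a)) = 0" using y(2) by simp
    have "\<exists>a<n. y a \<noteq> 0"
      using y(4) by (metis (no_types, lifting) lessThan_iff mult_zero_left sum.neutral)
    then show "\<exists>a<n. y a / sdeg a \<noteq> 0" using sdeg_pos by (metis divide_eq_0_iff less_irrefl)
  qed
  have orth: "(\<Sum>a<n. u i a * u j a) = (if i = j then 1 else 0)" if "i < n" "j < n" for i j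
    using u that by (simp add: eigenbasis_def)
  show thesis
  proof (cases "(\<Sum>a<n. sdeg a * u 1 a) = 0")
    case True
    then show thesis using step[of "u 1" 1] eig[of _ 1] orth[of 1 1] n by simp
  next
    case False
    define g where "g a = u 1 a / sdeg a" for a
    have g: "(\<Sum>b<n. w a b * (g a - g b)) = ev 1 * wdeg n w a * g a" if "a < n" for a
      unfolding g_def using eigenvector_equation[of "u 1" "ev 1", OF _ that] eig n by simp
    \<comment> \<open>Summed over all vertices, the left side of the equation for \<open>g\<close>
      vanishes by symmetry. Since \<open>g\<close> is not orthogonal to the degrees,
      \<open>ev 1\<close> must be 0.\<close>
    have "(\<Sum>a<n. \<Sum>b<n. w a b * (g a - g b)) = (\<Sum>a<n. \<Sum>b<n. w a b * g a) - (\<Sum>a<n. \<Sum>b<n. w a b * g b)"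
      by (simp add: right_diff_distrib sum_subtractf)
    then have "(\<Sum>a<n. \<Sum>b<n. w a b * (g a - g b)) = 0" by (simp add: sum_weight_fst sum_weight_snd)
    then have "ev 1 * (\<Sum>a<n. wdeg n w a * g a) = 0" using g by (simp add: sum_distrib_left mult.assoc)
    moreover have "(\<Sum>a<n. wdeg n w a * g a) = (\<Sum>a<n. sdeg a * u 1 a)"
      unfolding g_def by (intro sum.cong refl) (simp only: lessThan_iff deg_div_sdeg)
    ultimately have ev1: "ev 1 = 0" using False by simp
    then have ev0: "ev 0 = 0" using ev_mono[of 0 1] ev_nonneg[of 0] n by simp
    define p q where "p = (\<Sum>a<n. sdeg a * u 0 a)" and "q = (\<Sum>a<n. sdeg a * u 1 a)"
    \<comment> \<open>The coefficients make \<open>y\<close> orthogonal to \<open>sdeg\<close>;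
      \<open>q\<close> is nonzero in this case, so the coordinate at \<open>u 0\<close>
      survives.\<close>
    define y where "y a = q * u 0 a - p * u 1 a" for a
    show thesis
    proof (rule step[of y 0])
      show "(\<Sum>b<n. L $$ (a,b) * y b) = ev 1 * y a" if "a < n" for a
      proof -
        have "(\<Sum>b<n. L $$ (a,b) * y b) = q * (\<Sum>b<n. L $$ (a,b) * u 0 b) - p * (\<Sum>b<n. L $$ (a,b) * u 1 b)"
          by (simp add: y_def right_diff_distrib sum_subtractf sum_distrib_left mult_ac)
        then show ?thesis using eig[OF that, of 0] eig[OF that, of 1] n ev0 ev1 by simp
      qed
      have "(\<Sum>a<n. sdeg a * y a) = q * p - p * q"
        unfolding y_def p_def q_def sum_distrib_left[of "\<Sum>a<n. _ a"]
        by (simp add: right_diff_distrib sum_subtractf sum_distrib_left mult_ac)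
      then show "(\<Sum>a<n. sdeg a * y a) = 0" by simp
      show "0 < n" using n by simp
      have "(\<Sum>a<n. y a * u 0 a) = q * (\<Sum>a<n. u 0 a * u 0 a) - p * (\<Sum>a<n. u 1 a * u 0 a)"
        by (simp add: y_def algebra_simps sum_subtractf sum_distrib_left)
      then show "(\<Sum>a<n. y a * u 0 a) \<noteq> 0"
        using orth[of 0 0] orth[of 1 0] n False by (simp add: q_def)
    qed
  qed
qed

text \<open>Truncation is monotone and 1-Lipschitz, so one factor of each squared difference may be
  replaced by that of \<open>g\<close>. Testing the equation against the positive part then gives
  \<open>l\<close> times its squared norm, because the two functions agree where the positive part
  is nonzero.\<close>

lemma positive_part_energy:
  assumes g: "\<And>a. a < n \<Longrightarrow> (\<Sum>b<n. w a b * (g a - g b)) = l * wdeg n w a * g a"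
  shows "energy n w (\<lambda>v. max 0 (g v)) \<le> l * sqnorm n w (\<lambda>v. max 0 (g v))"
proof -
  let ?f = "\<lambda>v. max 0 (g v)"
  have "energy n w ?f \<le> (\<Sum>u<n. \<Sum>v<n. w u v * ((?f u - ?f v) * (g u - g v))) / 2"
    unfolding energy_def
  proof (intro divide_right_mono sum_weight_mono)
    fix u v show "(?f u - ?f v)\<^sup>2 \<le> (?f u - ?f v) * (g u - g v)"
      by (auto simp: max_def power2_eq_square algebra_simps mult_le_0_iff mult_nonneg_nonpos
          intro: mult_left_mono mult_right_mono order_trans[of _ 0])
  qed simp
  also have "(\<Sum>u<n. \<Sum>v<n. w u v * ((?f u - ?f v) * (g u - g v))) =
      (\<Sum>u<n. \<Sum>v<n. w u v * (?f u * (g u - g v))) + (\<Sum>u<n. \<Sum>v<n. w u v * (?f v * (g v - g u)))"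
    unfolding sum.distrib[symmetric] by (intro sum.cong refl) (simp add: algebra_simps)
  \<comment> \<open>Both halves are equal by symmetry, which cancels the division by 2 in
    \<open>energy\<close>.\<close>
  also have "(\<Sum>u<n. \<Sum>v<n. w u v * (?f v * (g v - g u))) = (\<Sum>u<n. \<Sum>v<n. w u v * (?f u * (g u - g v)))"
    by (rule sum_weight_sym)
  also have "(\<Sum>u<n. \<Sum>v<n. w u v * (?f u * (g u - g v))) = (\<Sum>u<n. ?f u * (\<Sum>v<n. w u v * (g u - g v)))"
    by (simp add: sum_distrib_left mult_ac)
  also have "\<dots> = (\<Sum>u<n. l * (wdeg n w u * (?f u)\<^sup>2))"
    by (intro sum.cong refl) (auto simp: g max_def power2_eq_square)
  also have "\<dots> = l * sqnorm n w ?f" by (simp add: sqnorm_def sum_distrib_left)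
  finally show ?thesis by simp
qed

section \<open>Volumes, cuts and total variation\<close>

lemma vol_mono: "S \<subseteq> T \<Longrightarrow> T \<subseteq> {..<n} \<Longrightarrow> vol n w S \<le> vol n w T"
  unfolding vol_def by (intro sum_mono2) (auto intro: finite_subset less_imp_le deg_pos)

lemma vol_pos: "S \<subseteq> {..<n} \<Longrightarrow> S \<noteq> {} \<Longrightarrow> vol n w S > 0"
  unfolding vol_def by (intro sum_pos) (auto intro: finite_subset deg_pos)

lemma vol_le_complement_mono:
  assumes "S' \<subseteq> S" "S \<subseteq> {..<n}" "vol n w S \<le> vol n w ({..<n} - S)"
  shows "vol n w S' \<le> vol n w ({..<n} - S')"
proof -
  have "vol n w S' \<le> vol n w S" using vol_mono assms by blast
  also have "\<dots> \<le> vol n w ({..<n} - S)" by fact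
  also have "\<dots> \<le> vol n w ({..<n} - S')" using assms by (intro vol_mono) auto
  finally show ?thesis .
qed

text \<open>Both \<open>g\<close> and \<open>- g\<close> solve the eigenvector equation, and their
  positive supports are disjoint, so one of the supports has at most half of the volume.\<close>

lemma small_support_test_function:
  assumes n: "2 \<le> n"
  obtains f where "\<And>v. f v \<ge> 0" "\<exists>v<n. f v > 0" "energy n w f \<le> ev 1 * sqnorm n w f"
    "vol n w {v. v < n \<and> f v > 0} \<le> vol n w ({..<n} - {v. v < n \<and> f v > 0})"
proof -
  obtain g where g: "\<And>a. a < n \<Longrightarrow> (\<Sum>b<n. w a b * (g a - g b)) = ev 1 * wdeg n w a * g a"
    "(\<Sum>a<n. wdeg n w a * g a) = 0" "\<exists>a<n. g a \<noteq> 0"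
    using second_eigenvector[OF n] by blast
  \<comment> \<open>A nonzero function orthogonal to the positive degree vector must change
    sign.\<close>
  have pos: "\<exists>a<n. h a > 0" if z: "(\<Sum>a<n. wdeg n w a * h a) = 0" "\<exists>a<n. h a \<noteq> 0" for h
  proof (rule ccontr)
    assume "\<not> (\<exists>a<n. h a > 0)"
    then have le: "h a \<le> 0" if "a < n" for a using that by force
    have "(\<Sum>a<n. - (wdeg n w a * h a)) = 0" using z(1) by (simp add: sum_negf)
    then have zero: "\<forall>a\<in>{..<n}. - (wdeg n w a * h a) = 0"
      by (subst (asm) sum_nonneg_eq_0_iff)
         (use le deg_pos in \<open>auto simp: mult_le_0_iff less_imp_le\<close>)
    obtain a where a: "a < n" "h a \<noteq> 0" using z(2) by blast
    then have "wdeg n w a = 0" using bspec[OF zero, of a] by simp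
    then show False using deg_pos[OF a(1)] by simp
  qed
  note result = that
  have main: thesis if h: "\<And>a. a < n \<Longrightarrow> (\<Sum>b<n. w a b * (h a - h b)) = ev 1 * wdeg n w a * h a"
    "\<exists>a<n. h a > 0" "vol n w {v. v < n \<and> h v > 0} \<le> vol n w ({..<n} - {v. v < n \<and> h v > 0})" for h
    by (rule result[of "\<lambda>v. max 0 (h v)"]) (use h positive_part_energy[of h "ev 1"] in \<open>auto simp: less_max_iff_disj\<close>)
  show thesis
  proof (cases "vol n w {v. v < n \<and> g v > 0} \<le> vol n w ({..<n} - {v. v < n \<and> g v > 0})")
    case True
    then show thesis using main[OF g(1) pos[OF g(2,3)]] by blast
  next
    case False
    let ?N = "{v. v < n \<and> - g v > 0}"
    have "vol n w ?N \<le> vol n w ({..<n} - {v. v < n \<and> g v > 0})" by (rule vol_mono) auto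
    also have "\<dots> \<le> vol n w {v. v < n \<and> g v > 0}" using False by simp
    also have "\<dots> \<le> vol n w ({..<n} - ?N)" by (rule vol_mono) auto
    finally have v: "vol n w ?N \<le> vol n w ({..<n} - ?N)" .
    have e: "(\<Sum>b<n. w a b * (- g a - - g b)) = ev 1 * wdeg n w a * - g a" if "a < n" for a
    proof -
      have "(\<Sum>b<n. w a b * (- g a - - g b)) = - (\<Sum>b<n. w a b * (g a - g b))"
        unfolding sum_negf[symmetric] by (intro sum.cong refl) (simp add: algebra_simps)
      then show ?thesis using g(1)[OF that] by simp
    qed
    have "(\<Sum>a<n. wdeg n w a * - g a) = 0" "\<exists>a<n. - g a \<noteq> 0" using g by (simp_all add: sum_negf)
    then show thesis using main[of "\<lambda>a. - g a", OF e pos v] by blast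
  qed
qed

text \<open>The multiplied form also covers the empty set. For nonempty \<open>S\<close> the volume
  condition excludes \<open>S = {..<n}\<close> and decides the minimum in
  \<open>conductance\<close>.\<close>

lemma conductance_cut:
  assumes S: "S \<subseteq> {..<n}" "vol n w S \<le> vol n w ({..<n} - S)"
  shows "graph_conductance n w * vol n w S \<le> cut_weight n w S"
proof (cases "S = {}")
  case True
  then show ?thesis by (simp add: vol_def cut_weight_def)
next
  case False
  then have pos: "vol n w S > 0" using vol_pos S by blast
  moreover have "vol n w {} = 0" by (simp add: vol_def)
  ultimately have ne: "S \<noteq> {..<n}" using S by auto
  have "finite {conductance n w S | S. S \<subseteq> {..<n} \<and> S \<noteq> {} \<and> S \<noteq> {..<n}}"
    by (rule finite_subset[of _ "conductance n w ` Pow {..<n}"]) auto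
  then have "graph_conductance n w \<le> conductance n w S"
    unfolding graph_conductance_def using S False ne by (intro Min_le) auto
  also have "\<dots> = cut_weight n w S / vol n w S" using S by (simp add: conductance_def)
  finally show ?thesis using pos by (simp add: field_simps)
qed

text \<open>The sum runs over ordered pairs and therefore meets each cut edge in both
  directions.\<close>

lemma cut_weight_eq:
  assumes "S \<subseteq> {..<n}"
  shows "(\<Sum>u<n. \<Sum>v<n. w u v * (if (u \<in> S) \<noteq> (v \<in> S) then 1 else 0)) = 2 * cut_weight n w S"
proof -
  let ?i = "\<lambda>u v. if u \<in> S \<and> v \<notin> S then 1 else (0::real)"
  have "cut_weight n w S = (\<Sum>u\<in>{..<n} \<inter> S. \<Sum>v\<in>{..<n} \<inter> - S. w u v)"
    unfolding cut_weight_def using assms by (intro sum.cong) auto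
  also have "\<dots> = (\<Sum>u<n. \<Sum>v<n. w u v * ?i u v)"
    by (auto simp: sum.inter_restrict intro!: sum.cong)
  finally have c: "cut_weight n w S = (\<Sum>u<n. \<Sum>v<n. w u v * ?i u v)" .
  have "(\<Sum>u<n. \<Sum>v<n. w u v * (if (u \<in> S) \<noteq> (v \<in> S) then 1 else 0)) =
      (\<Sum>u<n. \<Sum>v<n. w u v * ?i u v) + (\<Sum>u<n. \<Sum>v<n. w u v * ?i v u)"
    unfolding sum.distrib[symmetric] by (intro sum.cong refl) auto
  then show ?thesis using sum_weight_sym[of ?i] c by simp
qed

text \<open>Layer-cake summation over the superlevel sets of \<open>h\<close>, peeling off the lowest level first.\<close>

lemma conductance_total_variation:
  assumes "\<And>v. v < n \<Longrightarrow> h v \<ge> 0"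
    and "vol n w {v. v < n \<and> h v > 0} \<le> vol n w ({..<n} - {v. v < n \<and> h v > 0})"
  shows "2 * graph_conductance n w * (\<Sum>v<n. wdeg n w v * h v) \<le> (\<Sum>u<n. \<Sum>v<n. w u v * \<bar>h u - h v\<bar>)"
  using assms
proof (induction "card {v. v < n \<and> h v > 0}" arbitrary: h rule: less_induct)
  case less
  define S where "S = {v. v < n \<and> h v > 0}"
  have S: "S \<subseteq> {..<n}" "finite S" by (auto simp: S_def)
  have h0: "h v = 0" if "v < n" "v \<notin> S" for v using less.prems(1) that by (force simp: S_def)
  show ?case
  proof (cases "S = {}")
    case True
    then have "(\<Sum>v<n. wdeg n w v * h v) = 0" using h0 by simp
    moreover have "(\<Sum>u<n. \<Sum>v<n. w u v * \<bar>h u - h v\<bar>) \<ge> 0"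
      by (intro sum_nonneg mult_nonneg_nonneg) (auto simp: weight_nonneg)
    ultimately show ?thesis by simp
  next
    case False
    define m where "m = Min (h ` S)"
    have m: "m \<in> h ` S" "\<And>v. v \<in> S \<Longrightarrow> m \<le> h v" using S False by (auto simp: m_def)
    then have mpos: "m > 0" by (auto simp: S_def)
    \<comment> \<open>Removes the lowest positive layer, of height \<open>m\<close> over the whole
      support.\<close>
    define h' where "h' v = h v - (if v \<in> S then m else 0)" for v
    define S' where "S' = {v. v < n \<and> h' v > 0}"
    have nn: "h' v \<ge> 0" if "v < n" for v using m(2) less.prems(1)[OF that] by (auto simp: h'_def)
    have S': "S' \<subseteq> S"
    proof
      fix v assume "v \<in> S'"
      then show "v \<in> S" using h0[of v] by (cases "v \<in> S") (auto simp: S'_def h'_def)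
    qed
    moreover obtain p where "p \<in> S" "h p = m" using m(1) by auto
    \<comment> \<open>A vertex where the minimum is attained leaves the support, so the induction
      measure drops.\<close>
    then have "p \<in> S - S'" by (auto simp: S'_def h'_def)
    ultimately have "card S' < card S" using S by (intro psubset_card_mono) auto
    moreover have "vol n w S' \<le> vol n w ({..<n} - S')"
      using vol_le_complement_mono[OF S' S(1)] less.prems(2) by (simp add: S_def)
    ultimately have IH: "2 * graph_conductance n w * (\<Sum>v<n. wdeg n w v * h' v) \<le> (\<Sum>u<n. \<Sum>v<n. w u v * \<bar>h' u - h' v\<bar>)"
      using less.hyps[of h'] nn by (simp add: S_def S'_def)
    have "(\<Sum>v<n. wdeg n w v * h v) = (\<Sum>v<n. wdeg n w v * h' v + m * (if v \<in> S then wdeg n w v else 0))"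
      by (intro sum.cong refl) (auto simp: h'_def algebra_simps)
    also have "\<dots> = (\<Sum>v<n. wdeg n w v * h' v) + m * vol n w S"
      using S by (simp add: sum.distrib vol_def Int_absorb1 flip: sum_distrib_left sum.inter_restrict)
    finally have 1: "(\<Sum>v<n. wdeg n w v * h v) = (\<Sum>v<n. wdeg n w v * h' v) + m * vol n w S" .
    \<comment> \<open>The layer contributes exactly on pairs cut by \<open>S\<close>, without
      cancellation: outside \<open>S\<close> both functions vanish, and inside \<open>h'\<close> is
      nonnegative.\<close>
    have "\<bar>h u - h v\<bar> = \<bar>h' u - h' v\<bar> + m * (if (u \<in> S) \<noteq> (v \<in> S) then 1 else 0)" if "u < n" "v < n" for u v
      using nn[OF that(1)] nn[OF that(2)] h0[OF that(1)] h0[OF that(2)] mpos by (auto simp: h'_def)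
    then have "(\<Sum>u<n. \<Sum>v<n. w u v * \<bar>h u - h v\<bar>) =
        (\<Sum>u<n. \<Sum>v<n. w u v * \<bar>h' u - h' v\<bar> + m * (w u v * (if (u \<in> S) \<noteq> (v \<in> S) then 1 else 0)))"
      by (intro sum.cong refl) (simp add: distrib_left mult_ac)
    also have "\<dots> = (\<Sum>u<n. \<Sum>v<n. w u v * \<bar>h' u - h' v\<bar>) + m * (2 * cut_weight n w S)"
      unfolding cut_weight_eq[OF S(1), symmetric] sum.distrib sum_distrib_left ..
    finally have 2: "(\<Sum>u<n. \<Sum>v<n. w u v * \<bar>h u - h v\<bar>) =
        (\<Sum>u<n. \<Sum>v<n. w u v * \<bar>h' u - h' v\<bar>) + m * (2 * cut_weight n w S)" .
    have "m * (2 * (graph_conductance n w * vol n w S)) \<le> m * (2 * cut_weight n w S)"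
      using conductance_cut[OF S(1)] less.prems(2) mpos by (simp add: S_def)
    then show ?thesis unfolding 1 2 using IH by (simp add: algebra_simps)
  qed
qed

lemma sum_energy_le:
  assumes "finite I"
    and "\<And>u v. u < n \<Longrightarrow> v < n \<Longrightarrow> (\<Sum>i\<in>I. (F i u - F i v)\<^sup>2) \<le> (f u - f v)\<^sup>2"
  shows "(\<Sum>i\<in>I. energy n w (F i)) \<le> energy n w f"
proof -
  have "(\<Sum>i\<in>I. \<Sum>u<n. \<Sum>v<n. w u v * (F i u - F i v)\<^sup>2) = (\<Sum>u<n. \<Sum>v<n. w u v * (\<Sum>i\<in>I. (F i u - F i v)\<^sup>2))"
    unfolding sum_distrib_left by (rule sum_swap3)
  also have "\<dots> \<le> (\<Sum>u<n. \<Sum>v<n. w u v * (f u - f v)\<^sup>2)"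
    by (rule sum_weight_mono) (use assms in auto)
  finally show ?thesis by (simp add: energy_def flip: sum_divide_distrib)
qed

section \<open>The improved Cheeger inequality\<close>

lemma few_thresholds:
  assumes k: "0 < k" "k \<le> n" and lam: "ev (k - 1) > 0"
    and f: "\<And>v. v < n \<Longrightarrow> 0 \<le> f v" "\<And>v. v < n \<Longrightarrow> f v \<le> M" and M: "0 \<le> M"
    and B: "energy n w f \<le> B" "0 < B"
  obtains t :: "nat \<Rightarrow> real" where "t 0 = 0" "\<And>i. t i \<le> t (Suc i)" "t (2 * k) = M"
    "\<And>i. sqnorm n w (\<lambda>v. tent (t i) (t (Suc i)) (f v)) \<le> 3 * B / (real k * ev (k - 1))"
proof -
  \<comment> \<open>The factor 3 exceeds the 2 of \<open>ev_le_disjoint_supports\<close>, which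
    makes the contradiction below strict.\<close>
  define c where "c = 3 * B / (real k * ev (k - 1))"
  have c: "0 < c" using B k lam by (simp add: c_def)
  define F where "F t i v = tent (t i) (t (Suc i)) (f v)" for t :: "nat \<Rightarrow> real" and i v
  obtain t :: "nat \<Rightarrow> real" where t: "t 0 = 0" "\<And>i. t i \<le> t (Suc i)" "\<And>i. t i \<le> M"
      "\<And>i. sqnorm n w (F t i) \<le> c" "\<And>i. sqnorm n w (F t i) = c \<or> t (Suc i) = M"
    unfolding sqnorm_def F_def
    by (rule tent_thresholds_exist[where V = "{..<n}" and d = "wdeg n w" and f = f, OF M less_imp_le[OF c]]) blast
  have mono: "t i \<le> t j" if "i \<le> j" for i j
    using lift_Suc_mono_le[of t] t(2) that by blast
  have "\<exists>i<2 * k. t (Suc i) = M"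
  proof (rule ccontr)
    assume "\<not> ?thesis"
    then have norm: "sqnorm n w (F t i) = c" if "i < 2 * k" for i using t(5)[of i] that by auto
    have "(\<Sum>i<2 * k. energy n w (F t i)) \<le> energy n w f"
    proof (rule sum_energy_le)
      fix u v assume uv: "u < n" "v < n"
      show "(\<Sum>i<2 * k. (F t i u - F t i v)\<^sup>2) \<le> (f u - f v)\<^sup>2"
      proof -
        \<comment> \<open>The thresholds need not reach \<open>M\<close> here, so \<open>M\<close> is appended as a last one.\<close>
        define s where "s i = (if i \<le> 2 * k then t i else M)" for i
        have s: "s i \<le> s (Suc i)" for i using t(2,3) by (auto simp: s_def not_less_eq_eq le_antisym)
        have "(\<Sum>i<2 * k. (F t i u - F t i v)\<^sup>2) = (\<Sum>i<2 * k. (F s i u - F s i v)\<^sup>2)"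
          by (intro sum.cong refl) (auto simp: F_def s_def)
        also have "\<dots> \<le> (\<Sum>i<Suc (2 * k). (F s i u - F s i v)\<^sup>2)" by simp
        also have "\<dots> \<le> (f u - f v)\<^sup>2"
          unfolding F_def
          by (rule sum_tent_diff_squares[of s, OF s]) (use f uv t(1) in \<open>auto simp: s_def\<close>)
        finally show ?thesis .
      qed
    qed simp
    then have E: "(\<Sum>i<2 * k. energy n w (F t i)) \<le> B" using B by simp
    \<comment> \<open>Markov's inequality: at most \<open>k\<close> of the \<open>2 * k\<close>
      tents have energy above \<open>B / real k\<close>, so at least \<open>k\<close> cheap ones
      remain.\<close>
    define J where "J = {i. i < 2 * k \<and> energy n w (F t i) > B / real k}"
    have J: "J \<subseteq> {..<2 * k}" "finite J" by (auto simp: J_def)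
    have "real (card J) * (B / real k) \<le> (\<Sum>i\<in>J. energy n w (F t i))"
      by (rule sum_bounded_below) (auto simp: J_def)
    also have "\<dots> \<le> (\<Sum>i<2 * k. energy n w (F t i))"
      by (rule sum_mono2) (use J energy_nonneg in auto)
    also have "\<dots> \<le> B" by (rule E)
    finally have "card J \<le> k" using B k by (simp add: field_simps)
    then have card: "k - 1 < card ({..<2 * k} - J)" using J k by (simp add: card_Diff_subset)
    have "ev (k - 1) * c \<le> 2 * (B / real k)"
    proof (rule ev_le_disjoint_supports[where F = "F t" and I = "{..<2 * k} - J"])
      show "i = j" if "F t i v \<noteq> 0" "F t j v \<noteq> 0" for i j v
      proof -
        have *: "t i < f v" "f v < t (Suc i)" "t j < f v" "f v < t (Suc j)"
          using that by (auto simp: F_def tent_neq_0_iff)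
        show ?thesis
        proof (rule ccontr)
          assume "i \<noteq> j"
          then have "Suc i \<le> j \<or> Suc j \<le> i" by auto
          then show False using mono[of "Suc i" j] mono[of "Suc j" i] * by auto
        qed
      qed
    qed (use k card norm in \<open>auto simp: J_def\<close>)
    moreover have "ev (k - 1) * c = 3 * (B / real k)" using lam by (simp add: c_def)
    moreover have "B / real k > 0" using B k by simp
    ultimately show False by simp
  qed
  then obtain i where "i < 2 * k" "t (Suc i) = M" by blast
  then have "t (2 * k) = M" using mono[of "Suc i" "2 * k"] t(3)[of "2 * k"] by simp
  then show thesis using that[of t] t unfolding F_def c_def by blast
qed

text \<open>Cheeger rounding of the summed tent integrals of \<open>f\<close>. The parameter
  \<open>s\<close> weights the edge differences of \<open>f\<close> against its distance to the
  thresholds.\<close>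

lemma conductance_bound_at_thresholds:
  assumes f: "\<And>v. v < n \<Longrightarrow> 0 \<le> f v" "\<And>v. v < n \<Longrightarrow> f v \<le> t m"
    and supp: "vol n w {v. v < n \<and> f v > 0} \<le> vol n w ({..<n} - {v. v < n \<and> f v > 0})"
    and t: "t 0 = 0" "\<And>i. t i \<le> t (Suc i)"
    and c: "\<And>i. sqnorm n w (\<lambda>v. tent (t i) (t (Suc i)) (f v)) \<le> c"
    and pos: "graph_conductance n w \<ge> 0" and s: "s > 0"
  shows "graph_conductance n w * sqnorm n w f \<le> 2 * real m * ((1 + 1 / s) * energy n w f + 2 * s * real m * c)"
proof -
  define h where "h v = (\<Sum>i<m. tent_integral (t i) (t (Suc i)) (f v))" for v
  \<comment> \<open>The distance from \<open>f v\<close> to the nearest threshold, for vertices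
    \<open>v < n\<close>.\<close>
  define r where "r v = sqrt (\<Sum>i<m. (tent (t i) (t (Suc i)) (f v))\<^sup>2)" for v
  have r0: "r v \<ge> 0" for v by (simp add: r_def sum_nonneg)
  have h0: "h v \<ge> 0" for v
    unfolding h_def by (intro sum_nonneg order_trans[OF _ tent_integral_ge] t) auto
  have t0: "0 \<le> t i" for i using lift_Suc_mono_le[of t 0 i] t by simp
  have "h v = 0" if "v < n" "f v = 0" for v
    unfolding h_def that(2) using t0 t(2)
    by (intro sum.neutral ballI tent_integral_eq_0) auto
  \<comment> \<open>The support of \<open>h\<close> inherits the volume condition from that of
    \<open>f\<close>.\<close>
  then have sub: "{v. v < n \<and> h v > 0} \<subseteq> {v. v < n \<and> f v > 0}"
    using f(1) by (force simp: less_le)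
  have low: "(f v)\<^sup>2 \<le> 4 * real m * h v" if "v < n" for v
    unfolding h_def using sum_tent_integral_ge[of t "f v" m, OF t(2)] t(1) f that by simp
  have diff: "\<bar>h u - h v\<bar> \<le> (1 / (2 * s) + 1 / 2) * (f u - f v)\<^sup>2 + (s * (r u)\<^sup>2 + s * (r v)\<^sup>2)"
    if uv: "u < n" "v < n" for u v
  proof -
    have *: "\<bar>h u - h v\<bar> \<le> \<bar>f u - f v\<bar> * r v + (f u - f v)\<^sup>2 / 2" if "u < n" "v < n" "f v \<le> f u" for u v
      unfolding h_def r_def
      using sum_tent_integral_diff_le[of t "f v" "f u" m, OF t(2)] t(1) f that by simp
    \<comment> \<open>The Taylor bound uses \<open>r\<close> at the vertex with the smaller value;
      the sum \<open>r u + r v\<close> covers both orders.\<close>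
    have le: "\<bar>h u - h v\<bar> \<le> \<bar>f u - f v\<bar> * (r u + r v) + (f u - f v)\<^sup>2 / 2"
    proof (cases "f v \<le> f u")
      case True
      then show ?thesis using *[OF uv] r0[of u] by (smt (verit) mult_left_mono abs_ge_zero)
    next
      case False
      then have "\<bar>h v - h u\<bar> \<le> \<bar>f v - f u\<bar> * r u + (f v - f u)\<^sup>2 / 2" using *[OF uv(2,1)] by simp
      also have "\<bar>f v - f u\<bar> * r u \<le> \<bar>f v - f u\<bar> * (r u + r v)" using r0[of v] by (intro mult_left_mono) auto
      finally show ?thesis by (simp add: abs_minus_commute power2_commute)
    qed
    have am_gm: "x * y \<le> x\<^sup>2 / (2 * s) + s * y\<^sup>2 / 2" for x y :: real
    proof -
      have "x\<^sup>2 / (2 * s) + s * y\<^sup>2 / 2 - x * y = (x - s * y)\<^sup>2 / (2 * s)"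
        using s by (simp add: field_simps power2_eq_square)
      also have "\<dots> \<ge> 0" using s by simp
      finally show ?thesis by simp
    qed
    have "s * (r u + r v)\<^sup>2 / 2 \<le> s * (r u)\<^sup>2 + s * (r v)\<^sup>2"
    proof -
      have "(r u + r v)\<^sup>2 \<le> 2 * ((r u)\<^sup>2 + (r v)\<^sup>2)"
        using zero_le_power2[of "r u - r v"] by (simp add: power2_sum power2_diff)
      then have "s * (r u + r v)\<^sup>2 \<le> s * (2 * ((r u)\<^sup>2 + (r v)\<^sup>2))" using s by (intro mult_left_mono) auto
      then show ?thesis by (simp add: algebra_simps)
    qed
    then show ?thesis
      using le am_gm[of "\<bar>f u - f v\<bar>" "r u + r v"] by (simp add: distrib_right)
  qed
  define TV where "TV = (\<Sum>u<n. \<Sum>v<n. w u v * \<bar>h u - h v\<bar>)"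
  have "graph_conductance n w * sqnorm n w f \<le> graph_conductance n w * (4 * real m * (\<Sum>v<n. wdeg n w v * h v))"
  proof (rule mult_left_mono[OF _ pos])
    have "sqnorm n w f \<le> (\<Sum>v<n. wdeg n w v * (4 * real m * h v))"
      unfolding sqnorm_def by (intro sum_mono mult_left_mono) (auto simp: low deg_pos less_imp_le)
    then show "sqnorm n w f \<le> 4 * real m * (\<Sum>v<n. wdeg n w v * h v)"
      by (simp add: sum_distrib_left mult_ac)
  qed
  also have "\<dots> = 2 * real m * (2 * graph_conductance n w * (\<Sum>v<n. wdeg n w v * h v))" by simp
  also have "\<dots> \<le> 2 * real m * TV" unfolding TV_def
    using vol_le_complement_mono[OF sub _ supp]
    by (intro mult_left_mono conductance_total_variation h0) auto
  finally have 1: "graph_conductance n w * sqnorm n w f \<le> 2 * real m * TV" .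
  have "TV \<le>
      (\<Sum>u<n. \<Sum>v<n. w u v * ((1 / (2 * s) + 1 / 2) * (f u - f v)\<^sup>2 + (s * (r u)\<^sup>2 + s * (r v)\<^sup>2)))"
    unfolding TV_def by (rule sum_weight_mono) (rule diff)
  also have "\<dots> = (1 / (2 * s) + 1 / 2) * (\<Sum>u<n. \<Sum>v<n. w u v * (f u - f v)\<^sup>2)
      + ((\<Sum>u<n. \<Sum>v<n. w u v * (s * (r u)\<^sup>2)) + (\<Sum>u<n. \<Sum>v<n. w u v * (s * (r v)\<^sup>2)))"
    by (simp add: distrib_left sum.distrib sum_distrib_left mult_ac)
  also have "\<dots> = (1 + 1 / s) * energy n w f + 2 * s * sqnorm n w r"
    unfolding sum_weight_fst[of "\<lambda>v. s * (r v)\<^sup>2"] sum_weight_snd[of "\<lambda>v. s * (r v)\<^sup>2"]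
    by (simp add: energy_def sqnorm_def sum_distrib_left algebra_simps)
  finally have 2: "TV \<le> (1 + 1 / s) * energy n w f + 2 * s * sqnorm n w r" .
  have "sqnorm n w r = (\<Sum>i<m. sqnorm n w (\<lambda>v. tent (t i) (t (Suc i)) (f v)))"
    unfolding sqnorm_def r_def by (simp add: sum_nonneg sum_distrib_left) (rule sum.swap)
  also have "\<dots> \<le> real m * c" using sum_bounded_above[of "{..<m}" _ c] c by fastforce
  finally have "2 * s * sqnorm n w r \<le> 2 * s * (real m * c)" using s by (intro mult_left_mono) auto
  with 2 have "TV \<le> (1 + 1 / s) * energy n w f + 2 * s * real m * c" by (simp add: mult.assoc)
  then have "2 * real m * TV \<le> 2 * real m * ((1 + 1 / s) * energy n w f + 2 * s * real m * c)"
    by (rule mult_left_mono) simp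
  with 1 show ?thesis by (rule order_trans)
qed

text \<open>Uses \<open>2 * k\<close> thresholds and \<open>s = sqrt (ev (k - 1))\<close>. The
  constant is \<open>60 = 4 * 15\<close>: the rounding contributes \<open>4 * real k\<close>, the
  bracket at most \<open>15 * B / s\<close>.\<close>

lemma improved_cheeger:
  assumes k: "2 \<le> k" "k \<le> n" and lam: "ev (k - 1) > 0"
  shows "graph_conductance n w \<le> 60 * real k * ev 1 / sqrt (ev (k - 1))"
proof (cases "graph_conductance n w \<le> 0")
  case True
  also have "0 \<le> 60 * real k * ev 1 / sqrt (ev (k - 1))"
    using ev_nonneg[of 1] lam k by simp
  finally show ?thesis .
next
  case False
  then have pos: "graph_conductance n w > 0" by simp
  have ev1: "0 \<le> ev 1" using ev_nonneg k by simp
  have n: "2 \<le> n" using k by simp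
  obtain f where f: "\<And>v. f v \<ge> 0" "\<exists>v<n. f v > 0" "energy n w f \<le> ev 1 * sqnorm n w f"
    and supp: "vol n w {v. v < n \<and> f v > 0} \<le> vol n w ({..<n} - {v. v < n \<and> f v > 0})"
    by (rule small_support_test_function[OF n]) blast
  obtain p where p: "p < n" "f p > 0" using f(2) by blast
  have N: "sqnorm n w f > 0"
    unfolding sqnorm_def using p deg_pos by (intro sum_pos2[of _ p]) (auto simp: less_imp_le)
  \<comment> \<open>Otherwise \<open>f\<close> has no energy and is constant along edges; the total
    variation bound for \<open>f\<close> itself would then contradict positive conductance.\<close>
  have "ev 1 > 0"
  proof (rule ccontr)
    assume "\<not> ev 1 > 0"
    then have "ev 1 = 0" using ev1 by simp
    then have zero: "(\<Sum>u<n. \<Sum>v<n. w u v * (f u - f v)\<^sup>2) = 0"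
      using f(3) energy_nonneg[of f] by (simp add: energy_def)
    have "w u v * \<bar>f u - f v\<bar> = 0" if "u < n" "v < n" for u v
    proof -
      have "(\<Sum>v<n. w u v * (f u - f v)\<^sup>2) = 0"
        by (rule sum_nonneg_0[OF _ _ zero]) (use that in \<open>auto intro!: sum_nonneg simp: weight_nonneg\<close>)
      from sum_nonneg_0[OF _ _ this, of v] have "w u v * (f u - f v)\<^sup>2 = 0"
        using that by (auto simp: weight_nonneg)
      then show ?thesis by auto
    qed
    then have "(\<Sum>u<n. \<Sum>v<n. w u v * \<bar>f u - f v\<bar>) = 0"
      by (intro sum.neutral ballI) auto
    moreover have "(\<Sum>v<n. wdeg n w v * f v) > 0"
      using p deg_pos f(1) by (intro sum_pos2[of _ p]) (auto simp: less_imp_le)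
    ultimately show False
      using conductance_total_variation[OF f(1) supp] pos by (simp add: mult_le_0_iff)
  qed
  define B where "B = ev 1 * sqnorm n w f"
  have B: "energy n w f \<le> B" "0 < B" using f(3) N \<open>ev 1 > 0\<close> by (simp_all add: B_def)
  define M where "M = Max (f ` {..<n})"
  have M: "f v \<le> M" if "v < n" for v using that by (simp add: M_def)
  have M0: "0 \<le> M" using M[OF p(1)] p(2) by simp
  define s where "s = sqrt (ev (k - 1))"
  have s: "0 < s" "s\<^sup>2 = ev (k - 1)" using lam by (simp_all add: s_def)
  have "ev (k - 1) \<le> 2" by (rule ev_le_2) (use k in linarith)
  then have "s\<^sup>2 \<le> 2\<^sup>2" using s by simp
  then have s2: "s \<le> 2" by (rule power2_le_imp_le) simp
  obtain t :: "nat \<Rightarrow> real" where t: "t 0 = 0" "\<And>i. t i \<le> t (Suc i)" "t (2 * k) = M"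
    "\<And>i. sqnorm n w (\<lambda>v. tent (t i) (t (Suc i)) (f v)) \<le> 3 * B / (real k * s\<^sup>2)"
    unfolding s(2) by (rule few_thresholds[OF _ k(2) lam f(1) M M0 B]) (use k in auto)
  have "graph_conductance n w * sqnorm n w f \<le>
      2 * real (2 * k) * ((1 + 1 / s) * energy n w f + 2 * s * real (2 * k) * (3 * B / (real k * s\<^sup>2)))"
    using conductance_bound_at_thresholds[of f t "2 * k", OF f(1) _ supp t(1,2,4) less_imp_le[OF pos] s(1)] M t(3)
    by simp
  \<comment> \<open>The factor \<open>2 * k\<close> from the number of thresholds cancels the
    \<open>k\<close> in the weight of each tent.\<close>
  also have "2 * s * real (2 * k) * (3 * B / (real k * s\<^sup>2)) = 12 * B / s"
    using k s(1) by (simp add: field_simps power2_eq_square)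
  finally have bound: "graph_conductance n w * sqnorm n w f \<le>
      2 * real (2 * k) * ((1 + 1 / s) * energy n w f + 12 * B / s)" .
  have "(1 + 1 / s) * energy n w f + 12 * B / s \<le> 15 * B / s"
  proof -
    \<comment> \<open>Here \<open>s \<le> 2\<close> absorbs the summand 1 into
      \<open>2 / s\<close>.\<close>
    have "(1 + 1 / s) * energy n w f \<le> (2 / s + 1 / s) * B"
      using s(1) s2 B by (intro mult_mono add_right_mono energy_nonneg) (auto simp: field_simps)
    also have "\<dots> = 15 * B / s - 12 * B / s" using s(1) by (simp add: field_simps)
    finally show ?thesis by simp
  qed
  then have "2 * real (2 * k) * ((1 + 1 / s) * energy n w f + 12 * B / s) \<le> 2 * real (2 * k) * (15 * B / s)"
    by (rule mult_left_mono) simp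
  with bound have "graph_conductance n w * sqnorm n w f \<le> 2 * real (2 * k) * (15 * B / s)"
    by (rule order_trans)
  then have "graph_conductance n w * sqnorm n w f \<le> (60 * real k * ev 1 / s) * sqnorm n w f"
    by (simp add: B_def field_simps)
  then have "graph_conductance n w \<le> 60 * real k * ev 1 / s"
    using N by (rule mult_right_le_imp_le)
  then show ?thesis by (simp only: s_def)
qed

end

theorem theorem1p1:
  shows "\<exists>C>0. \<forall>(n::nat) (w::nat \<Rightarrow> nat \<Rightarrow> real) (k::nat).
     wgraph n w \<and> (\<forall>v<n. wdeg n w v \<ge> 1) \<and> 2 \<le> k \<and> k \<le> n \<and> lap_eig n w k > 0 \<longrightarrow>
     graph_conductance n w \<le> C * real k * lap_eig n w 2 / sqrt (lap_eig n w k)"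
proof (intro exI[of _ 60] conjI allI impI)
  fix n w k
  assume *: "wgraph n w \<and> (\<forall>v<n. wdeg n w v \<ge> 1) \<and> 2 \<le> k \<and> k \<le> n \<and> lap_eig n w k > 0"
  interpret weighted_graph n w
    by unfold_locales (use * in \<open>auto simp: wgraph_def less_le_trans[OF zero_less_one]\<close>)
  \<comment> \<open>Index shift: \<open>lap_eig\<close> counts from 1, so
    \<open>lap_eig n w 2\<close> is \<open>ev 1\<close>.\<close>
  show "graph_conductance n w \<le> 60 * real k * lap_eig n w 2 / sqrt (lap_eig n w k)"
    using improved_cheeger[of k] * by (simp add: lap_eig_def)
qed simp

end
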